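(* Let $D_1$ and $D_2$ be chord diagrams with two components, and suppose that their intersection graphs coincide, $\Gamma(D_1)=\Gamma(D_2)=T$, where $T$ is a trimmed tree. Then $D_1$ and $D_2$ are equivalent modulo the 1-term and 4-term relations.
   Context: **Chord diagrams.** A chord diagram of degree $n$ with $k$ components is a disjoint union of $k$ oriented line segments (the components, colored $1,\dots,k$) together with $n$ chords (unoriented line segments with endpoints on the components) such that the $2n$ endpoints of the chords are all distinct. A chord may have both endpoints on the same component or on two different components. The diagram is determined by the orders of the chord endpoints on each component. Endpoint $e_1$ is "below" $e_2$ if they lie on the same component and its orientation runs from $e_1$ to $e_2$. **Relations.** Consider the real vector space spanned by the chord diagrams with $k$ components, graded by degree. Two diagrams are equivalent modulo the 1-term and 4-term relations if their difference lies in the subspace spanned by the following elements. - 1-term relation: every diagram having a chord whose two endpoints lie on the same component with no other chord endpoint between them is set equal to $0$. - 4-term relation: take three disjoint arcs $\alpha,\beta,\gamma$ of the components (possibly on the same or on different components). Consider four diagrams that agree except for two chords. In all four, the first chord joins $\alpha$ to $\beta$, and the second chord has one endpoint on $\gamma$. The other endpoint of the second chord lies on $\alpha$ immediately above (diagram $D_{\alpha+}$) or immediately below (diagram $D_{\alpha-}$) the endpoint of the first chord on $\alpha$, or on $\beta$ immediately above ($D_{\beta+}$) or immediately below ($D_{\beta-}$) the endpoint of the first chord on $\beta$. No other chord has an endpoint on $\alpha,\beta,\gamma$. Then $D_{\alpha+}-D_{\alpha-}+D_{\beta+}-D_{\beta-}=0$. **Intersection graph.** The intersection graph $\Gamma(D)$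 of a chord diagram $D$ is the following labeled directed multigraph. It has one vertex for each chord of $D$, labeled by the unordered pair $\{i,j\}$ of (labels of) the components on which the endpoints of the chord lie ($i=j$ allowed). For distinct vertices $v_1,v_2$ there is a directed edge from $v_1$ to $v_2$ for each pair $(e_1,e_2)$ where $e_1$ is an endpoint of the chord of $v_1$, $e_2$ is an endpoint of the chord of $v_2$, both lie on the same component, and $e_1$ is below $e_2$. These edges are counted mod 2, i.e. two directed edges with the same source and target cancel. If after cancellation there is a directed edge in each direction between two vertices, the two are replaced by a single undirected edge. Equality of intersection graphs means isomorphism preserving labels and edges (with directions). **Marked and unmarked vertices.** A vertex (or its chord) is unmarked if its label is $\{i,i\}$ for some $i$, and marked if its label is $\{i,j\}$ with $i\neq j$. **Boughs.** A bough of a vertex $v$ in a tree $T$ with marked and unmarked vertices is a connected component of $T\setminus v$ (the graph obtained by removing $v$ and all edges incident to $v$). A bough of $v$ is light if it contains at most one marked vertex and this vertex, if present, is adjacent to $v$ in $T$. **Trimmed tree.** An intersection graph $T$ of a chord diagram with 2 components is a trimmed tree if it is an undirected tree (it is a tree all of whose edges are undirected edges, i.e. every edge of $T$ is a single undirected edge that replaced a pair of directed edges, one in each direction between its two end vertices, remaining after the mod 2 cancellation) and there is some vertex $v$ of $T$ (called the trunk) such that every bough of $v$ is light. *)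

theory Defs
  imports "HOL-Analysis.Finite_Function_Topology"
begin

section \<open>Chord diagrams\<close>

text \<open>
  A diagram with \<open>k\<close> components is a list of \<open>k\<close> words.  The \<open>i\<close>-th word lists, along the
  orientation of component \<open>i\<close>, the names of the chords whose endpoints are met, so every name
  that occurs at all occurs exactly twice.  Components are numbered \<open>0, \<dots>, k - 1\<close>.
  Chord names carry no meaning: the diagram proper is the class \<open>diagram_class D\<close> of all
  injective renamings.
\<close>

type_synonym diagram = "nat list list"

definition chords :: "diagram \<Rightarrow> nat set" where
  "chords D = set (concat D)"

definition chord_diagram :: "nat \<Rightarrow> diagram \<Rightarrow> bool" where
  "chord_diagram k D \<longleftrightarrow> length D = k \<and> (\<forall>c \<in> chords D. count_list (concat D) c = 2)"

definition diagram_class :: "diagram \<Rightarrow> diagram set" where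
  "diagram_class D = {map (map f) D |f. inj_on f (chords D)}"


section \<open>The 1-term and 4-term relations\<close>

type_synonym diagram_space = "diagram set \<Rightarrow>\<^sub>0 real"

definition diagram_vector :: "diagram \<Rightarrow> diagram_space" where
  "diagram_vector D = Poly_Mapping.single (diagram_class D) 1"

definition has_isolated_chord :: "diagram \<Rightarrow> bool" where
  "has_isolated_chord D \<longleftrightarrow> (\<exists>w \<in> set D. \<exists>u c v. w = u @ [c, c] @ v)"

definition one_term_relators :: "nat \<Rightarrow> diagram_space set" where
  "one_term_relators k = {diagram_vector D |D. chord_diagram k D \<and> has_isolated_chord D}"

text \<open>
  A frame is the part shared by the four diagrams of a 4-term relation: words in the endpoints
  of the remaining chords and the three arcs.  In \<open>fill_frame F u v w\<close> the words \<open>u\<close>, \<open>v\<close>, \<open>w\<close>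
  of chord endpoints are put on the arcs \<open>\<alpha>\<close>, \<open>\<beta>\<close>, \<open>\<gamma>\<close>.
\<close>

datatype site = Endpoint nat | Alpha | Beta | Gamma

fun fill_site :: "nat list \<Rightarrow> nat list \<Rightarrow> nat list \<Rightarrow> site \<Rightarrow> nat list" where
  "fill_site u v w (Endpoint c) = [c]"
| "fill_site u v w Alpha = u"
| "fill_site u v w Beta = v"
| "fill_site u v w Gamma = w"

definition fill_frame :: "site list list \<Rightarrow> nat list \<Rightarrow> nat list \<Rightarrow> nat list \<Rightarrow> diagram" where
  "fill_frame F u v w = map (\<lambda>s. concat (map (fill_site u v w) s)) F"

text \<open>
  The first chord is \<open>a\<close>, the second is \<open>b\<close>; the word \<open>[a, b]\<close> puts the endpoint of \<open>b\<close>
  immediately above that of \<open>a\<close>, and \<open>[b, a]\<close> immediately below.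
  If one of the four fillings is a chord diagram, so are the other three.
\<close>

definition four_term_relators :: "nat \<Rightarrow> diagram_space set" where
  "four_term_relators k =
    {diagram_vector (fill_frame F [a, b] [a] [b]) - diagram_vector (fill_frame F [b, a] [a] [b])
     + diagram_vector (fill_frame F [a] [a, b] [b]) - diagram_vector (fill_frame F [a] [b, a] [b])
     |F a b. a \<noteq> b \<and>
        count_list (concat F) Alpha = 1 \<and>
        count_list (concat F) Beta = 1 \<and>
        count_list (concat F) Gamma = 1 \<and>
        chord_diagram k (fill_frame F [a, b] [a] [b])}"

definition equivalent_mod_1T_4T :: "nat \<Rightarrow> diagram \<Rightarrow> diagram \<Rightarrow> bool" where
  "equivalent_mod_1T_4T k D D' \<longleftrightarrow>
    diagram_vector D - diagram_vector D' \<in> span (one_term_relators k \<union> four_term_relators k)"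


section \<open>Intersection graphs\<close>

record ('v, 'l) mixed_graph =
  vertices :: "'v set"
  label :: "'v \<Rightarrow> 'l"
  darcs :: "('v \<times> 'v) set"
  uedges :: "'v set set"

definition mixed_graph_iso :: "('v, 'l) mixed_graph \<Rightarrow> ('w, 'l) mixed_graph \<Rightarrow> bool" where
  "mixed_graph_iso G H \<longleftrightarrow>
    (\<exists>f. bij_betw f (vertices G) (vertices H) \<and>
      (\<forall>v \<in> vertices G. label H (f v) = label G v) \<and>
      (\<forall>u \<in> vertices G. \<forall>v \<in> vertices G.
        ((f u, f v) \<in> darcs H \<longleftrightarrow> (u, v) \<in> darcs G) \<and>
        ({f u, f v} \<in> uedges H \<longleftrightarrow> {u, v} \<in> uedges G)))"

text \<open>An endpoint \<open>(i, p)\<close> is position \<open>p\<close> on component \<open>i\<close>.\<close>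

definition endpoints :: "diagram \<Rightarrow> nat \<Rightarrow> (nat \<times> nat) set" where
  "endpoints D c = {(i, p). i < length D \<and> p < length (D ! i) \<and> D ! i ! p = c}"

definition below :: "nat \<times> nat \<Rightarrow> nat \<times> nat \<Rightarrow> bool" where
  "below e1 e2 \<longleftrightarrow> fst e1 = fst e2 \<and> snd e1 < snd e2"

definition arc_multiplicity :: "diagram \<Rightarrow> nat \<Rightarrow> nat \<Rightarrow> nat" where
  "arc_multiplicity D c d =
    card {(e1, e2). e1 \<in> endpoints D c \<and> e2 \<in> endpoints D d \<and> below e1 e2}"

definition arcs_mod_2 :: "diagram \<Rightarrow> (nat \<times> nat) set" where
  "arcs_mod_2 D =
    {(c, d). c \<in> chords D \<and> d \<in> chords D \<and> c \<noteq> d \<and> odd (arc_multiplicity D c d)}"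

text \<open>The label \<open>{i, j}\<close> is the singleton \<open>{i}\<close> when \<open>i = j\<close>.\<close>

definition intersection_graph :: "diagram \<Rightarrow> (nat, nat set) mixed_graph" where
  "intersection_graph D = \<lparr>
    vertices = chords D,
    label = (\<lambda>c. fst ` endpoints D c),
    darcs = {(c, d). (c, d) \<in> arcs_mod_2 D \<and> (d, c) \<notin> arcs_mod_2 D},
    uedges = {{c, d} |c d. (c, d) \<in> arcs_mod_2 D \<and> (d, c) \<in> arcs_mod_2 D}\<rparr>"


section \<open>Trimmed trees\<close>

definition marked :: "('v, 'c set) mixed_graph \<Rightarrow> 'v \<Rightarrow> bool" where
  "marked G v \<longleftrightarrow> (\<exists>i j. i \<noteq> j \<and> label G v = {i, j})"

definition adjacency_within :: "'v set set \<Rightarrow> 'v set \<Rightarrow> 'v rel" where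
  "adjacency_within E S = {(x, y). x \<in> S \<and> y \<in> S \<and> {x, y} \<in> E}"

definition connected_graph :: "'v set \<Rightarrow> 'v set set \<Rightarrow> bool" where
  "connected_graph V E \<longleftrightarrow> V \<noteq> {} \<and> (\<forall>x \<in> V. \<forall>y \<in> V. (x, y) \<in> (adjacency_within E V)\<^sup>*)"

definition graph_cycle :: "'v set \<Rightarrow> 'v set set \<Rightarrow> 'v list \<Rightarrow> bool" where
  "graph_cycle V E vs \<longleftrightarrow>
    3 \<le> length vs \<and> distinct vs \<and> set vs \<subseteq> V \<and>
    successively (\<lambda>x y. {x, y} \<in> E) vs \<and> {last vs, hd vs} \<in> E"

definition undirected_tree :: "('v, 'l) mixed_graph \<Rightarrow> bool" where
  "undirected_tree G \<longleftrightarrow>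
    darcs G = {} \<and> connected_graph (vertices G) (uedges G) \<and>
    (\<nexists>vs. graph_cycle (vertices G) (uedges G) vs)"

definition boughs :: "('v, 'l) mixed_graph \<Rightarrow> 'v \<Rightarrow> 'v set set" where
  "boughs G v =
    {{y. (x, y) \<in> (adjacency_within (uedges G) (vertices G - {v}))\<^sup>*} |x. x \<in> vertices G - {v}}"

definition light_bough :: "('v, 'c set) mixed_graph \<Rightarrow> 'v \<Rightarrow> 'v set \<Rightarrow> bool" where
  "light_bough G v B \<longleftrightarrow>
    card {x \<in> B. marked G x} \<le> 1 \<and> (\<forall>x \<in> B. marked G x \<longrightarrow> {v, x} \<in> uedges G)"

definition trimmed_tree :: "('v, 'c set) mixed_graph \<Rightarrow> bool" where
  "trimmed_tree G \<longleftrightarrow>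
    undirected_tree G \<and> (\<exists>v \<in> vertices G. \<forall>B \<in> boughs G v. light_bough G v B)"

end

theory Submission
  imports Defs "HOL-Library.Multiset"
begin

text \<open>
  It suffices that every linear functional vanishing on the relators takes the same value on the two
  diagrams (\<open>in_span_if_functionals_vanish\<close>).  Rename the chords so that both diagrams have the same
  named intersection graph.  The theorem then says: a real function \<open>f\<close> of diagrams with named chords
  that satisfies the 4-term relation takes equal values on diagrams whose common graph is a trimmed
  tree.  This is proved by removing unmarked leaves one at a time, for all such \<open>f\<close> simultaneously
  (\<open>trimmed_tree_determines_value\<close>).

  Let \<open>x\<close> be an unmarked leaf with neighbour \<open>u\<close>.  The part of the diagram enclosed by \<open>x\<close> meets the
  rest only through one foot of \<open>u\<close>.  Sums of 4-term relations allow \<open>x\<close> to be shrunk to that foot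
  (\<open>leaf_slides_inwards\<close>) and to be moved to the other foot (\<open>leaf_may_sit_at_either_foot\<close>), up to
  diagrams in which \<open>x\<close> is an isolated chord.  Therefore the value of \<open>f\<close> is the value of a function
  \<open>leaf_removed f x u\<close> on the diagram without \<open>x\<close> (\<open>remove_unmarked_leaf\<close>).  The essential point is
  that this new function satisfies the 4-term relation again (\<open>four_term_leaf_removed\<close>): a small leaf
  is a decoration of the chord \<open>u\<close> that takes no part in how the chord moves.  So instead of
  comparing arrangements of boughs, the two diagrams lose the same leaf and \<open>f\<close> is changed in the same
  way for both.

  Since marked vertices are next to the trunk, leaves other than the trunk can be removed until only
  the trunk and marked children of it are left (\<open>leaf_or_star\<close>).  Such a star has few drawings: the
  children are parallel, in some order, and if the trunk is marked they pass it on one of two sides.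
  All these drawings are related by moving a chord past a pair of words, one at each of its feet, that
  together consist of whole chords (\<open>chord_commutes_with_closed_pair\<close>).
\<close>

section \<open>The 4-term relation on flat words\<close>

text \<open>
  The two strands are written as one word \<open>A @ s # B\<close>, where the letter \<open>s\<close> is the gap between
  them.  A 4-term relation compares places next to the feet of one chord, so it never moves an
  endpoint across the gap, and one linear word serves for all distributions of the three arcs
  over the strands.
\<close>
definition flat_word :: "nat \<Rightarrow> nat set \<Rightarrow> nat list \<Rightarrow> bool" where
  "flat_word s V Y \<longleftrightarrow> (\<forall>c. count_list Y c = (if c = s then 1 else if c \<in> V then 2 else 0))"

lemma flat_word_perm:
  assumes "flat_word s V Y" "mset Z = mset Y"
  shows "flat_word s V Z"
  using assms unfolding flat_word_def by (metis count_mset)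

text \<open>
  The chord \<open>a\<close> has both feet shown.  The chord \<open>b\<close> has one fixed foot somewhere in \<open>A\<close>, \<open>B\<close> or \<open>C\<close>,
  and its other foot visits the four places next to the feet of \<open>a\<close>.  Chords carry names and \<open>f\<close>
  may tell them apart: this freedom is what lets the induction replace \<open>f\<close> by a function in which
  some chords are decorated.
\<close>
definition four_term :: "nat \<Rightarrow> nat set \<Rightarrow> (nat list \<Rightarrow> real) \<Rightarrow> bool" where
  "four_term s V f \<longleftrightarrow>
    (\<forall>A B C a b. b \<noteq> s \<longrightarrow> flat_word s V (b # A @ a # B @ a # C) \<longrightarrow>
      f (A @ a # b # B @ a # C) - f (A @ b # a # B @ a # C)
      + f (A @ a # B @ a # b # C) - f (A @ a # B @ b # a # C) = 0)"

lemma four_termD: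
  assumes "four_term s V f" "flat_word s V (b # A @ a # B @ a # C)" "b \<noteq> s"
  shows "f (A @ a # b # B @ a # C) + f (A @ a # B @ a # b # C)
    = f (A @ b # a # B @ a # C) + f (A @ a # B @ b # a # C)"
  using assms unfolding four_term_def by (smt (verit, best))

definition closed_word :: "nat list \<Rightarrow> bool" where
  "closed_word W \<longleftrightarrow> (\<forall>c \<in> set W. count_list W c = 2)"

lemma occurrence_pair:
  assumes "count_list Y c = 2"
  obtains A B C where "Y = A @ c # B @ c # C" "c \<notin> set A" "c \<notin> set B" "c \<notin> set C"
proof -
  have "c \<in> set Y" using assms by (metis count_list_0_iff zero_neq_numeral)
  then obtain A R where Y: "Y = A @ c # R" and A: "c \<notin> set A"
    by (meson split_list_first)
  have R: "count_list R c = 1" using assms A Y by (simp add: count_notin)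
  then have "c \<in> set R" by (metis count_list_0_iff zero_neq_one)
  then obtain B C where BC: "R = B @ c # C" "c \<notin> set B"
    by (meson split_list_first)
  have "c \<notin> set C" using R BC by (auto simp: count_notin count_list_0_iff)
  with that Y A BC show ?thesis by simp
qed

text \<open>
  The value jumps each time the free foot of \<open>b\<close> steps over a letter.  By the 4-term relation the two
  jumps at the feet of a chord cancel, hence so do the jumps over any set of places that contains
  with each foot also the other foot of the same chord.
\<close>
lemma sum_over_closed_positions:
  fixes Y :: "nat list" and f :: "nat list \<Rightarrow> real"
  defines "step \<equiv> \<lambda>b k. f (take (Suc k) Y @ b # drop (Suc k) Y) - f (take k Y @ b # drop k Y)"
  assumes f: "four_term s V f" and w: "flat_word s V (b # Y)" and b: "b \<noteq> s"
    and K: "K \<subseteq> {..<length Y}"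
    and two: "\<And>k. k \<in> K \<Longrightarrow> count_list Y (Y ! k) = 2"
    and full: "\<And>k j. k \<in> K \<Longrightarrow> j < length Y \<Longrightarrow> Y ! j = Y ! k \<Longrightarrow> j \<in> K"
  shows "(\<Sum>k\<in>K. step b k) = 0"
proof -
  have fin: "finite K" using K finite_subset by blast
  have "(\<Sum>k | k \<in> K \<and> Y ! k = c. step b k) = 0" if c: "c \<in> (\<lambda>k. Y ! k) ` K" for c
  proof -
    from c obtain k0 where k0: "k0 \<in> K" "c = Y ! k0" by auto
    obtain A B C where Y: "Y = A @ c # B @ c # C" and n: "c \<notin> set A" "c \<notin> set B" "c \<notin> set C"
      using occurrence_pair two[OF k0(1)] k0(2) by metis
    let ?i = "length A" and ?j = "length A + 1 + length B"
    have pos: "k = ?i \<or> k = ?j" if "k < length Y" "Y ! k = c" for k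
    proof (rule ccontr)
      assume a: "\<not> (k = ?i \<or> k = ?j)"
      consider "k < ?i" | "?i < k" "k < ?j" | "?j < k" using a by linarith
      then show False
      proof cases
        case 1 then show False using that n Y by (auto simp: nth_append)
      next
        case 2
        then have "Y ! k = B ! (k - ?i - 1)" using Y by (auto simp: nth_append nth_Cons')
        moreover have "k - ?i - 1 < length B" using 2 by linarith
          ultimately show False using that n by (metis nth_mem)
      next
        case 3
        then have "Y ! k = C ! (k - ?j - 1)" using Y by (auto simp: nth_append nth_Cons')
        moreover have "k - ?j - 1 < length C" using 3 that Y by auto
        ultimately show False using that n by (auto simp: in_set_conv_nth)
      qed
    qed
    have "Y ! ?i = c" "Y ! ?j = c" "?i < length Y" "?j < length Y"
      using Y by (auto simp: nth_append)
    then have "{k. k \<in> K \<and> Y ! k = c} = {?i, ?j}"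
      using full[OF k0(1)] k0(2) pos K by auto
    then have "(\<Sum>k | k \<in> K \<and> Y ! k = c. step b k) = step b ?i + step b ?j" by simp
    also have "\<dots> = 0"
    proof -
      have "f (A @ c # b # B @ c # C) + f (A @ c # B @ c # b # C)
          = f (A @ b # c # B @ c # C) + f (A @ c # B @ b # c # C)"
        using four_termD[OF f _ b, of A c B C] w Y by simp
      then show ?thesis unfolding step_def Y by simp
    qed
    finally show ?thesis .
  qed
  then show ?thesis
    using sum.image_gen[OF fin, of "step b" "\<lambda>k. Y ! k"] by simp
qed

text \<open>
  The generalised 4-term relation, from which all later identities are combined: telescoping the
  jumps over the two intervals \<open>W1\<close> and \<open>W2\<close>, which together consist of whole chords.
\<close>
lemma move_across_closed_pair:
  assumes f: "four_term s V f" and b: "b \<noteq> s"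
    and w: "flat_word s V (b # Y0 @ W1 @ Y1 @ W2 @ Y2)" and cl: "closed_word (W1 @ W2)"
  shows "f (Y0 @ W1 @ b # Y1 @ W2 @ Y2) + f (Y0 @ W1 @ Y1 @ W2 @ b # Y2)
    = f (Y0 @ b # W1 @ Y1 @ W2 @ Y2) + f (Y0 @ W1 @ Y1 @ b # W2 @ Y2)"
proof -
  define Y where "Y = Y0 @ W1 @ Y1 @ W2 @ Y2"
  define \<phi> where "\<phi> k = f (take k Y @ b # drop k Y)" for k
  let ?i = "length Y0" and ?j = "length Y0 + length W1 + length Y1"
  let ?K1 = "{?i..<?i + length W1}" and ?K2 = "{?j..<?j + length W2}"
  have cnt: "count_list Y c = 2" "c \<notin> set Y0" "c \<notin> set Y1" "c \<notin> set Y2"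
    if "c \<in> set W1 \<union> set W2" for c
  proof -
    have c: "count_list W1 c + count_list W2 c = 2"
      using cl that unfolding closed_word_def by auto
    have "count_list (b # Y) c \<le> 2"
      using w unfolding flat_word_def Y_def by (metis (no_types, lifting) nle_le one_le_numeral zero_le)
    then have "count_list Y0 c = 0 \<and> count_list Y1 c = 0 \<and> count_list Y2 c = 0"
      using c unfolding Y_def by (simp split: if_splits)
    then show "count_list Y c = 2" "c \<notin> set Y0" "c \<notin> set Y1" "c \<notin> set Y2"
      using c unfolding Y_def by (auto simp: count_list_0_iff)
  qed
  have inK: "Y ! k \<in> set W1 \<union> set W2" if "k \<in> ?K1 \<union> ?K2" for k
    using that unfolding Y_def by (auto simp: nth_append)
  have outK: "k \<in> ?K1 \<union> ?K2" if k: "k < length Y" "Y ! k \<in> set W1 \<union> set W2" for k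
  proof (rule ccontr)
    assume a: "k \<notin> ?K1 \<union> ?K2"
    have "Y ! k \<in> set Y0 \<union> set Y1 \<union> set Y2"
      using a k(1) unfolding Y_def by (auto simp: nth_append)
    with cnt k(2) show False by blast
  qed
  have "(\<Sum>k\<in>?K1 \<union> ?K2. \<phi> (Suc k) - \<phi> k) = 0"
    unfolding \<phi>_def
  proof (rule sum_over_closed_positions[OF f _ b])
    show "flat_word s V (b # Y)" using w unfolding Y_def .
    show "?K1 \<union> ?K2 \<subseteq> {..<length Y}" unfolding Y_def by auto
    show "count_list Y (Y ! k) = 2" if "k \<in> ?K1 \<union> ?K2" for k using cnt inK that by blast
    show "j \<in> ?K1 \<union> ?K2" if "k \<in> ?K1 \<union> ?K2" "j < length Y" "Y ! j = Y ! k" for k j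
      using that inK outK by metis
  qed
  moreover have "(\<Sum>k\<in>?K1 \<union> ?K2. \<phi> (Suc k) - \<phi> k)
      = (\<Sum>k\<in>?K1. \<phi> (Suc k) - \<phi> k) + (\<Sum>k\<in>?K2. \<phi> (Suc k) - \<phi> k)"
    by (rule sum.union_disjoint) auto
  moreover have "(\<Sum>k\<in>?K1. \<phi> (Suc k) - \<phi> k) = \<phi> (?i + length W1) - \<phi> ?i"
    using sum_Suc_diff'[of ?i "?i + length W1" \<phi>] by simp
  moreover have "(\<Sum>k\<in>?K2. \<phi> (Suc k) - \<phi> k) = \<phi> (?j + length W2) - \<phi> ?j"
    using sum_Suc_diff'[of ?j "?j + length W2" \<phi>] by simp
  moreover have "\<phi> ?i = f (Y0 @ b # W1 @ Y1 @ W2 @ Y2)"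
    "\<phi> (?i + length W1) = f (Y0 @ W1 @ b # Y1 @ W2 @ Y2)"
    "\<phi> ?j = f (Y0 @ W1 @ Y1 @ b # W2 @ Y2)"
    "\<phi> (?j + length W2) = f (Y0 @ W1 @ Y1 @ W2 @ b # Y2)"
    unfolding \<phi>_def Y_def by simp_all
  ultimately show ?thesis by linarith
qed

lemma closed_word_commutes:
  assumes f: "four_term s V f" and w: "flat_word s V (P @ W @ Q @ R)"
    and cl: "closed_word W" and Q: "s \<notin> set Q"
  shows "f (P @ W @ Q @ R) = f (P @ Q @ W @ R)"
  using w Q
proof (induction Q arbitrary: P)
  case (Cons b Q)
  have "f (P @ W @ b # Q @ R) = f (P @ b # W @ Q @ R)"
    using move_across_closed_pair[OF f _ flat_word_perm[OF Cons.prems(1)], of b P W "Q @ R" "[]" "[]"]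
      Cons.prems(2) cl by simp
  moreover have "f ((P @ [b]) @ W @ Q @ R) = f ((P @ [b]) @ Q @ W @ R)"
    using Cons.prems(2) by (intro Cons.IH flat_word_perm[OF Cons.prems(1)]) simp_all
  ultimately show ?case by simp
qed simp

section \<open>Removing a leaf\<close>

text \<open>closed insert\<close>

text \<open>
  A chord \<open>x\<close> around a word that meets the rest of the diagram only through the chord \<open>u\<close> may be
  shrunk to a neighbourhood of the foot of \<open>u\<close>, after correcting by the diagram in which \<open>x\<close> is
  isolated.  Let \<open>x\<close> run parallel to \<open>u\<close>: its second foot is just below or just above the far foot
  of \<open>u\<close>, and its first foot is before \<open>W1\<close>, before \<open>u\<close>, after \<open>u\<close> or after \<open>W2\<close>.  Write \<open>\<alpha>\<close>, \<open>\<beta>\<close>,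
  \<open>\<gamma>\<close>, \<open>\<delta>\<close> for the value below minus the value above at these four places.  The large leaf is
  \<open>\<alpha> = - \<delta>\<close>, the small one is \<open>\<beta> = - \<gamma>\<close>, and moving past \<open>W1\<close> and \<open>W2\<close> together gives
  \<open>\<alpha> - \<beta> + \<gamma> - \<delta> = 0\<close>; over the reals twice the large leaf equals twice the small one.
\<close>
lemma leaf_slides_inwards:
  assumes f: "four_term s V f" and w: "flat_word s V (x # x # P @ W1 @ u # W2 @ Q @ u # R)"
    and cl: "closed_word (W1 @ W2)" and us: "u \<noteq> s" and xs: "x \<noteq> s"
  shows "f (P @ x # W1 @ u # W2 @ x # Q @ u # R) - f (P @ x # x # W1 @ u # W2 @ Q @ u # R)
    = f (P @ W1 @ x # u # x # W2 @ Q @ u # R) - f (P @ W1 @ x # x # u # W2 @ Q @ u # R)"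
proof -
  have cl2: "closed_word ((W1 @ u # W2) @ [u])" "closed_word ([u] @ [u])" "closed_word [x, x]"
  proof -
    have "u \<notin> set W1 \<union> set W2"
    proof
      assume "u \<in> set W1 \<union> set W2"
      then have "count_list (W1 @ W2) u = 2" using cl unfolding closed_word_def by simp
      moreover have "count_list (x # x # P @ W1 @ u # W2 @ Q @ u # R) u \<le> 2"
        using w unfolding flat_word_def by (metis (no_types, lifting) nle_le one_le_numeral zero_le)
      ultimately show False by (simp split: if_splits)
    qed
    then show "closed_word ((W1 @ u # W2) @ [u])"
      using cl unfolding closed_word_def by (auto simp: count_notin)
  qed (simp_all add: closed_word_def)
  have sW: "s \<notin> set W1" "s \<notin> set W2"
  proof -
    have "count_list (W1 @ W2) s \<le> 1" using spec[OF w[unfolded flat_word_def], of s]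
      by (simp add: count_list_append split: if_splits)
    then have "\<not> s \<in> set (W1 @ W2)" using cl unfolding closed_word_def by fastforce
    then show "s \<notin> set W1" "s \<notin> set W2" by auto
  qed
  note mv = move_across_closed_pair[OF f xs flat_word_perm[OF w]]
  note cm = closed_word_commutes[OF f flat_word_perm[OF w] cl2(3)]
  note rw = add_mset_commute ac_simps
  \<comment> \<open>Facts \<open>a\<close> and \<open>d\<close> turn the large leaf into parallel chords, moving its right or its left foot
    past the word; facts \<open>b\<close> and \<open>c\<close> do the same for the small leaf.\<close>
  have a: "f (P @ x # W1 @ u # W2 @ x # Q @ u # R) + f (P @ x # W1 @ u # W2 @ Q @ u # x # R)
    = f (P @ x # x # W1 @ u # W2 @ Q @ u # R) + f (P @ x # W1 @ u # W2 @ Q @ x # u # R)"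
    using mv[of "P @ [x]" "W1 @ u # W2" Q "[u]" R] cl2 by (simp add: rw)
  have d: "f (P @ W1 @ u # W2 @ x # x # Q @ u # R) + f (P @ W1 @ u # W2 @ x # Q @ u # x # R)
    = f (P @ x # W1 @ u # W2 @ x # Q @ u # R) + f (P @ W1 @ u # W2 @ x # Q @ x # u # R)"
    using mv[of P "W1 @ u # W2" "x # Q" "[u]" R] cl2 by (simp add: rw)
  have b: "f (P @ W1 @ x # u # x # W2 @ Q @ u # R) + f (P @ W1 @ x # u # W2 @ Q @ u # x # R)
    = f (P @ W1 @ x # x # u # W2 @ Q @ u # R) + f (P @ W1 @ x # u # W2 @ Q @ x # u # R)"
    using mv[of "P @ W1 @ [x]" "[u]" "W2 @ Q" "[u]" R] cl2 by (simp add: rw)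
  have c: "f (P @ W1 @ u # x # x # W2 @ Q @ u # R) + f (P @ W1 @ u # x # W2 @ Q @ u # x # R)
    = f (P @ W1 @ x # u # x # W2 @ Q @ u # R) + f (P @ W1 @ u # x # W2 @ Q @ x # u # R)"
    using mv[of "P @ W1" "[u]" "x # W2 @ Q" "[u]" R] cl2 by (simp add: rw)
  \<comment> \<open>Facts \<open>m\<close> and \<open>p\<close> move the parallel chord past the closed pair \<open>W1\<close>, \<open>W2\<close> and skip \<open>u\<close>, with the
    far foot of \<open>x\<close> below and above that of \<open>u\<close>.\<close>
  have m: "f (P @ W1 @ x # u # W2 @ Q @ x # u # R) + f (P @ W1 @ u # W2 @ x # Q @ x # u # R)
    = f (P @ x # W1 @ u # W2 @ Q @ x # u # R) + f (P @ W1 @ u # x # W2 @ Q @ x # u # R)"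
    using mv[of P W1 "[u]" W2 "Q @ x # u # R"] cl by (simp add: rw)
  have p: "f (P @ W1 @ x # u # W2 @ Q @ u # x # R) + f (P @ W1 @ u # W2 @ x # Q @ u # x # R)
    = f (P @ x # W1 @ u # W2 @ Q @ u # x # R) + f (P @ W1 @ u # x # W2 @ Q @ u # x # R)"
    using mv[of P W1 "[u]" W2 "Q @ u # x # R"] cl by (simp add: rw)
  have c1: "f (P @ x # x # W1 @ u # W2 @ Q @ u # R) = f (P @ W1 @ x # x # u # W2 @ Q @ u # R)"
    using cm[of P W1] sW by (simp add: rw)
  have c2: "f (P @ W1 @ x # x # u # W2 @ Q @ u # R) = f (P @ W1 @ u # x # x # W2 @ Q @ u # R)"
    using cm[of "P @ W1" "[u]"] us by (simp add: rw)
  have c3: "f (P @ W1 @ u # x # x # W2 @ Q @ u # R) = f (P @ W1 @ u # W2 @ x # x # Q @ u # R)"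
    using cm[of "P @ W1 @ [u]" W2] sW by (simp add: rw)
  show ?thesis using a b c d m p c1 c2 c3 by linarith
qed

lemma four_term_rev:
  assumes "four_term s V f"
  shows "four_term s V (\<lambda>Y. f (rev Y))"
  unfolding four_term_def
proof (intro allI impI)
  fix A B C a b
  assume b: "b \<noteq> s" and w: "flat_word s V (b # A @ a # B @ a # C)"
  have "flat_word s V (b # rev C @ a # rev B @ a # rev A)"
    by (rule flat_word_perm[OF w]) simp
  from four_termD[OF assms this b]
  show "f (rev (A @ a # b # B @ a # C)) - f (rev (A @ b # a # B @ a # C))
      + f (rev (A @ a # B @ a # b # C)) - f (rev (A @ a # B @ b # a # C)) = 0"
    by simp
qed

lemma no_separator_in_closed_word:
  assumes "flat_word s V Y" "closed_word W" "\<And>c. count_list W c \<le> count_list Y c"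
  shows "s \<notin> set W"
proof
  assume "s \<in> set W"
  then have "count_list W s = 2" using assms(2) unfolding closed_word_def by blast
  moreover have "count_list Y s = 1" using assms(1) unfolding flat_word_def by simp
  ultimately show False using assms(3)[of s] by simp
qed

text \<open>
  The mirror image, for a leaf at the later foot of \<open>u\<close>: reading all words backwards preserves the
  4-term relation.  The isolated chord comes out on the wrong side and is moved through the word.
\<close>
lemma leaf_slides_inwards_second_foot:
  assumes f: "four_term s V f" and w: "flat_word s V (x # x # P @ u # Q @ W1 @ u # W2 @ R)"
    and cl: "closed_word (W1 @ W2)" and us: "u \<noteq> s" and xs: "x \<noteq> s"
  shows "f (P @ u # Q @ x # W1 @ u # W2 @ x # R) - f (P @ u # Q @ x # x # W1 @ u # W2 @ R)
    = f (P @ u # Q @ W1 @ x # u # x # W2 @ R) - f (P @ u # Q @ W1 @ x # x # u # W2 @ R)"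
proof -
  have sW: "s \<notin> set W1" "s \<notin> set W2"
    using no_separator_in_closed_word[OF w cl] by (simp_all add: count_list_append)
  have "closed_word (rev W2 @ rev W1)" using cl by (simp add: closed_word_def count_list_append ac_simps)
  from leaf_slides_inwards[OF four_term_rev[OF f] _ this us xs, of "rev R" "rev Q" "rev P"]
  have "f (P @ u # Q @ x # W1 @ u # W2 @ x # R) - f (P @ u # Q @ W1 @ u # W2 @ x # x # R)
      = f (P @ u # Q @ W1 @ x # u # x # W2 @ R) - f (P @ u # Q @ W1 @ u # x # x # W2 @ R)"
    by (simp add: flat_word_perm[OF w])
  moreover note cm = closed_word_commutes[OF f flat_word_perm[OF w], of _ "[x, x]"]
  have "f (P @ u # Q @ x # x # W1 @ u # W2 @ R) = f (P @ u # Q @ W1 @ u # W2 @ x # x # R)"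
    using cm[of "P @ u # Q" "W1 @ u # W2" R] sW us by (simp add: closed_word_def)
  moreover have "f (P @ u # Q @ W1 @ x # x # u # W2 @ R) = f (P @ u # Q @ W1 @ u # x # x # W2 @ R)"
    using cm[of "P @ u # Q @ W1" "[u]" "W2 @ R"] us by (simp add: closed_word_def)
  ultimately show ?thesis by simp
qed

text \<open>
  Either leaf, minus its isolated version, is a difference of two diagrams with \<open>x\<close> parallel to
  \<open>u\<close>.  Expanding each leaf in two ways, by moving the left or the right foot of \<open>x\<close>, the difference
  of the two leaves turns out to be its own negative.
\<close>
lemma leaf_may_sit_at_either_foot:
  assumes f: "four_term s V f" and w: "flat_word s V (x # x # P @ u # Q @ u # R)"
    and us: "u \<noteq> s" and xs: "x \<noteq> s"
  shows "f (P @ x # u # x # Q @ u # R) - f (P @ x # x # u # Q @ u # R)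
    = f (P @ u # Q @ x # u # x # R) - f (P @ u # Q @ x # x # u # R)"
proof -
  have uu: "closed_word ([u] @ [u])" by (simp add: closed_word_def)
  note mv = move_across_closed_pair[OF f xs flat_word_perm[OF w] uu]
  note cm = closed_word_commutes[OF f flat_word_perm[OF w], of _ "[x, x]"]
  note rw = add_mset_commute ac_simps
  have "f (P @ x # u # x # Q @ u # R) + f (P @ x # u # Q @ u # x # R)
      = f (P @ x # x # u # Q @ u # R) + f (P @ x # u # Q @ x # u # R)"
    using mv[of "P @ [x]" Q R] by (simp add: rw)
  moreover have "f (P @ u # x # x # Q @ u # R) + f (P @ u # x # Q @ u # x # R)
      = f (P @ x # u # x # Q @ u # R) + f (P @ u # x # Q @ x # u # R)"
    using mv[of P "x # Q" R] by (simp add: rw)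
  moreover have "f (P @ u # x # Q @ x # u # R) + f (P @ u # Q @ x # u # x # R)
      = f (P @ x # u # Q @ x # u # R) + f (P @ u # Q @ x # x # u # R)"
    using mv[of P "Q @ [x]" R] by (simp add: rw)
  moreover have "f (P @ u # x # Q @ u # x # R) + f (P @ u # Q @ u # x # x # R)
      = f (P @ x # u # Q @ u # x # R) + f (P @ u # Q @ x # u # x # R)"
    using mv[of P Q "x # R"] by (simp add: rw)
  moreover have "f (P @ x # x # u # Q @ u # R) = f (P @ u # x # x # Q @ u # R)"
    using cm[of P "[u]"] us by (simp add: closed_word_def rw)
  moreover have "f (P @ u # Q @ x # x # u # R) = f (P @ u # Q @ u # x # x # R)"
    using cm[of "P @ u # Q" "[u]"] us by (simp add: closed_word_def rw)
  ultimately show ?thesis by linarith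
qed

text \<open>
  A leaf \<open>x\<close> is hung on \<open>u\<close> and its isolated version is subtracted.  The subtraction makes the choice
  of foot immaterial even when the feet of \<open>u\<close> lie on different strands; the first one is taken.
\<close>
definition reduced_leaf :: "(nat list \<Rightarrow> real) \<Rightarrow> nat \<Rightarrow> nat \<Rightarrow> nat list \<Rightarrow> real" where
  "reduced_leaf f x u E =
    (let P = takeWhile (\<lambda>c. c \<noteq> u) E; Q = tl (dropWhile (\<lambda>c. c \<noteq> u) E)
     in f (P @ x # u # x # Q) - f (P @ x # x # u # Q))"

lemma reduced_leaf_eq:
  assumes f: "four_term s V f" and w: "flat_word s V (x # x # P @ u # Q)"
    and us: "u \<noteq> s" and xs: "x \<noteq> s"
  shows "reduced_leaf f x u (P @ u # Q) = f (P @ x # u # x # Q) - f (P @ x # x # u # Q)"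
proof (cases "u \<in> set P")
  case True
  then obtain P1 P2 where P: "P = P1 @ u # P2" and n: "u \<notin> set P1" by (meson split_list_first)
  have "reduced_leaf f x u (P @ u # Q)
      = f (P1 @ x # u # x # P2 @ u # Q) - f (P1 @ x # x # u # P2 @ u # Q)"
    unfolding reduced_leaf_def P Let_def using n by (auto simp: takeWhile_append dropWhile_append)
  also have "\<dots> = f (P1 @ u # P2 @ x # u # x # Q) - f (P1 @ u # P2 @ x # x # u # Q)"
    using leaf_may_sit_at_either_foot[OF f _ us xs] w unfolding P by simp
  finally show ?thesis unfolding P by simp
next
  case False
  then show ?thesis
    unfolding reduced_leaf_def Let_def by (auto simp: takeWhile_append dropWhile_append)
qed

text \<open>
  Both cases together: up to the isolated chord, it does not matter which whole chords \<open>x\<close> encloses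
  besides the foot of \<open>u\<close>, nor which foot of \<open>u\<close> that is.
\<close>
lemma surrounding_leaf:
  assumes f: "four_term s V f" and w: "flat_word s V (P @ x # W1 @ u # W2 @ x # Q)"
    and cl: "closed_word (W1 @ W2)" and us: "u \<noteq> s" and xs: "x \<noteq> s"
  shows "f (P @ x # W1 @ u # W2 @ x # Q)
    = reduced_leaf f x u (P @ W1 @ u # W2 @ Q) + f (P @ x # x # W1 @ u # W2 @ Q)"
proof -
  have u2: "count_list (P @ x # W1 @ u # W2 @ x # Q) u = 2"
    using w us unfolding flat_word_def by (metis count_list_0_iff in_set_conv_decomp append_Cons append_assoc)
  have ux: "u \<noteq> x" using u2 by (auto simp: count_list_append)
  have red: "reduced_leaf f x u (P @ W1 @ u # W2 @ Q)
      = f (P @ W1 @ x # u # x # W2 @ Q) - f (P @ W1 @ x # x # u # W2 @ Q)"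
    using reduced_leaf_eq[OF f flat_word_perm[OF w] us xs, of "P @ W1" "W2 @ Q"] 
    by (simp add: add_mset_commute ac_simps)
  have "\<not> (u \<in> set W1 \<union> set W2)"
  proof
    assume "u \<in> set W1 \<union> set W2"
    then have "count_list W1 u + count_list W2 u = 2"
      using cl unfolding closed_word_def by (auto simp: count_list_append)
    then show False using u2 by (simp add: count_list_append split: if_splits)
  qed
  then have "count_list P u + count_list Q u = 1"
    using u2 ux by (simp add: count_list_append count_notin)
  then consider "u \<in> set Q" | "u \<in> set P" by (metis add_0 count_list_0_iff zero_neq_one)
  then show ?thesis
  proof cases
    case 1
    then obtain Q1 Q2 where Q: "Q = Q1 @ u # Q2" by (meson split_list)
    show ?thesis
      using leaf_slides_inwards[OF f flat_word_perm[OF w] cl us xs, of P Q1 Q2] red Q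
      by (simp add: add_mset_commute ac_simps)
  next
    case 2
    then obtain P1 P2 where P: "P = P1 @ u # P2" by (meson split_list)
    show ?thesis
      using leaf_slides_inwards_second_foot[OF f flat_word_perm[OF w] cl us xs, of P1 P2 Q] red P
      by (simp add: add_mset_commute ac_simps)
  qed
qed

text \<open>
  Hanging a leaf on \<open>u\<close> preserves the 4-term relation.  If \<open>u\<close> is the fixed chord, the endpoint \<open>b\<close>
  moves over the closed pair formed by \<open>x u x\<close> and the other foot of \<open>u\<close>.  If \<open>u\<close> is the moving
  chord, the leaf is put on its foot that stays, and if \<open>u\<close> is neither chord, then it sits away from
  the action.
\<close>
lemma four_term_reduced_leaf:
  assumes f: "four_term s (insert x V) f" and xV: "x \<notin> V" and us: "u \<noteq> s" and xs: "x \<noteq> s"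
    and uV: "u \<in> V"
  shows "four_term s V (reduced_leaf f x u)"
  unfolding four_term_def
proof (intro allI impI)
  fix A B C a b
  assume b: "b \<noteq> s" and w0: "flat_word s V (b # A @ a # B @ a # C)"
  have w: "flat_word s (insert x V) (x # x # b # A @ a # B @ a # C)"
    using w0 xV xs unfolding flat_word_def by (auto simp: count_list_append)
  note rw = add_mset_commute ac_simps
  note red = reduced_leaf_eq[OF f flat_word_perm[OF w] us xs]
  note D = four_termD[OF f flat_word_perm[OF w] b]
  have "count_list (b # A @ a # B @ a # C) u = 2" using w0 uV us unfolding flat_word_def by simp
  then consider "u = a" | "u \<in> set A" | "u \<in> set B" | "u \<in> set C"
    by (force simp: count_list_append count_notin split: if_splits)
  then show "reduced_leaf f x u (A @ a # b # B @ a # C) - reduced_leaf f x u (A @ b # a # B @ a # C)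
      + reduced_leaf f x u (A @ a # B @ a # b # C) - reduced_leaf f x u (A @ a # B @ b # a # C) = 0"
  proof cases
    case 1
    note mv = move_across_closed_pair[OF f b flat_word_perm[OF w]]
    have "a \<noteq> x" "x \<noteq> a" using 1 uV xV by auto
    then have "f (A @ x # a # x # b # B @ a # C) + f (A @ x # a # x # B @ a # b # C)
        = f (A @ b # x # a # x # B @ a # C) + f (A @ x # a # x # B @ b # a # C)"
      using mv[of A "[x, a, x]" B "[a]" C] by (simp add: closed_word_def rw)
    moreover from \<open>a \<noteq> x\<close> have "f (A @ x # x # a # b # B @ a # C) + f (A @ x # x # a # B @ a # b # C)
        = f (A @ b # x # x # a # B @ a # C) + f (A @ x # x # a # B @ b # a # C)"
      using mv[of A "[x, x, a]" B "[a]" C] by (simp add: closed_word_def rw)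
    ultimately show ?thesis
      using 1 red[of A "b # B @ a # C"] red[of "A @ [b]" "B @ a # C"]
        red[of A "B @ a # b # C"] red[of A "B @ b # a # C"] by (simp add: rw)
  next
    case 2
    then obtain A1 A2 where [simp]: "A = A1 @ u # A2" by (meson split_list)
    show ?thesis
      using D[of "A1 @ x # u # x # A2" a B C] D[of "A1 @ x # x # u # A2" a B C]
        red[of A1 "A2 @ a # b # B @ a # C"] red[of A1 "A2 @ b # a # B @ a # C"]
        red[of A1 "A2 @ a # B @ a # b # C"] red[of A1 "A2 @ a # B @ b # a # C"]
      by (simp add: rw)
  next
    case 3
    then obtain B1 B2 where [simp]: "B = B1 @ u # B2" by (meson split_list)
    show ?thesis
      using D[of A a "B1 @ x # u # x # B2" C] D[of A a "B1 @ x # x # u # B2" C]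
        red[of "A @ a # b # B1" "B2 @ a # C"] red[of "A @ b # a # B1" "B2 @ a # C"]
        red[of "A @ a # B1" "B2 @ a # b # C"] red[of "A @ a # B1" "B2 @ b # a # C"]
      by (simp add: rw)
  next
    case 4
    then obtain C1 C2 where [simp]: "C = C1 @ u # C2" by (meson split_list)
    show ?thesis
      using D[of A a B "C1 @ x # u # x # C2"] D[of A a B "C1 @ x # x # u # C2"]
        red[of "A @ a # b # B @ a # C1" C2] red[of "A @ b # a # B @ a # C1" C2]
        red[of "A @ a # B @ a # b # C1" C2] red[of "A @ a # B @ b # a # C1" C2]
      by (simp add: rw)
  qed
qed

text \<open>
  The value of a diagram with a leaf \<open>x\<close> on \<open>u\<close>, as a function of the diagram without \<open>x\<close>.  The last
  summand gives back the isolated chord, parked at the outer end of the strand that carries \<open>x\<close>;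
  the flag says whether this is the left strand.
\<close>
definition leaf_removed :: "(nat list \<Rightarrow> real) \<Rightarrow> nat \<Rightarrow> nat \<Rightarrow> bool \<Rightarrow> nat list \<Rightarrow> real" where
  "leaf_removed f x u left E =
    reduced_leaf f x u E + (if left then f ([x, x] @ E) else f (E @ [x, x]))"

lemma four_term_leaf_removed:
  assumes f: "four_term s (insert x V) f" and xV: "x \<notin> V" and us: "u \<noteq> s" and xs: "x \<noteq> s"
    and uV: "u \<in> V"
  shows "four_term s V (leaf_removed f x u left)"
  unfolding four_term_def
proof (intro allI impI)
  fix A B C a b
  assume b: "b \<noteq> s" and w0: "flat_word s V (b # A @ a # B @ a # C)"
  have w: "flat_word s (insert x V) (x # x # b # A @ a # B @ a # C)"
    using w0 xV xs unfolding flat_word_def by (auto simp: count_list_append)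
  note D = four_termD[OF f flat_word_perm[OF w] b]
  show "leaf_removed f x u left (A @ a # b # B @ a # C) - leaf_removed f x u left (A @ b # a # B @ a # C)
      + leaf_removed f x u left (A @ a # B @ a # b # C) - leaf_removed f x u left (A @ a # B @ b # a # C) = 0"
    using four_termD[OF four_term_reduced_leaf[OF assms] w0 b]
      D[of "[x, x] @ A" a B C] D[of A a B "C @ [x, x]"]
    unfolding leaf_removed_def by (auto simp: add_mset_commute ac_simps)
qed

section \<open>Sliding a chord along a closed pair of words\<close>

text \<open>
  Let the feet of \<open>v\<close> be before or after \<open>W1\<close> and before or after \<open>W2\<close>.  Moving one foot of \<open>v\<close> past
  the pair while the other stays changes the value by a term in which both feet of \<open>v\<close> lie around the
  same word.  Going from both-before to both-after in the two possible orders gives opposite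
  corrections; so the corrections vanish in total, and the two mixed positions agree as well.
\<close>
lemma chord_commutes_with_closed_pair:
  assumes f: "four_term s V f" and w: "flat_word s V (v # v # P @ W1 @ Q @ W2 @ R)"
    and cl: "closed_word (W1 @ W2)" and vs: "v \<noteq> s"
  shows "f (P @ W1 @ v # Q @ W2 @ v # R) = f (P @ v # W1 @ Q @ v # W2 @ R)"
    and "f (P @ W1 @ v # Q @ v # W2 @ R) = f (P @ v # W1 @ Q @ W2 @ v # R)"
proof -
  have sW: "s \<notin> set W1" "s \<notin> set W2"
    using no_separator_in_closed_word[OF w cl] by (simp_all add: count_list_append)
  note mv = move_across_closed_pair[OF f vs flat_word_perm[OF w] cl]
  note cm = closed_word_commutes[OF f flat_word_perm[OF w], of _ "[v, v]"]
  note rw = add_mset_commute ac_simps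
  have "f (P @ W1 @ v # Q @ v # W2 @ R) + f (P @ W1 @ Q @ v # W2 @ v # R)
      = f (P @ v # W1 @ Q @ v # W2 @ R) + f (P @ W1 @ Q @ v # v # W2 @ R)"
    using mv[of P "Q @ [v]" R] by (simp add: rw)
  moreover have "f (P @ W1 @ v # Q @ W2 @ v # R) + f (P @ W1 @ Q @ W2 @ v # v # R)
      = f (P @ v # W1 @ Q @ W2 @ v # R) + f (P @ W1 @ Q @ v # W2 @ v # R)"
    using mv[of P Q "v # R"] by (simp add: rw)
  moreover have "f (P @ v # W1 @ v # Q @ W2 @ R) + f (P @ v # W1 @ Q @ W2 @ v # R)
      = f (P @ v # v # W1 @ Q @ W2 @ R) + f (P @ v # W1 @ Q @ v # W2 @ R)"
    using mv[of "P @ [v]" Q R] by (simp add: rw)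
  moreover have "f (P @ W1 @ v # v # Q @ W2 @ R) + f (P @ W1 @ v # Q @ W2 @ v # R)
      = f (P @ v # W1 @ v # Q @ W2 @ R) + f (P @ W1 @ v # Q @ v # W2 @ R)"
    using mv[of P "v # Q" R] by (simp add: rw)
  moreover have "f (P @ v # v # W1 @ Q @ W2 @ R) = f (P @ W1 @ v # v # Q @ W2 @ R)"
    using cm[of P W1] sW by (simp add: closed_word_def rw)
  moreover have "f (P @ W1 @ Q @ v # v # W2 @ R) = f (P @ W1 @ Q @ W2 @ v # v # R)"
    using cm[of "P @ W1 @ Q" W2] sW by (simp add: closed_word_def rw)
  ultimately show "f (P @ W1 @ v # Q @ W2 @ v # R) = f (P @ v # W1 @ Q @ v # W2 @ R)"
    and "f (P @ W1 @ v # Q @ v # W2 @ R) = f (P @ v # W1 @ Q @ W2 @ v # R)"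
    by linarith+
qed

lemma closed_word_doubled: "distinct A \<Longrightarrow> closed_word (A @ A)"
proof (induction A)
  case (Cons a A)
  then show ?case unfolding closed_word_def by (fastforce simp: count_list_append count_notin)
qed (simp add: closed_word_def)

text \<open>
  The chord that is to come first moves past the chords in front of it, which form a closed pair.
\<close>
lemma parallel_chords_permute:
  assumes f: "four_term s V f" and "flat_word s V (P @ W @ Q @ W @ R)"
    and "distinct W" "distinct W'" "set W' = set W" "s \<notin> set W"
  shows "f (P @ W @ Q @ W @ R) = f (P @ W' @ Q @ W' @ R)"
  using assms(2-)
proof (induction W arbitrary: P Q W')
  case (Cons c W)
  obtain A B where W': "W' = A @ c # B" using Cons.prems(4) by (metis list.set_intros(1) split_list)
  have "c \<noteq> s" using Cons.prems(5) by auto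
  have AB: "distinct (A @ B)" "set (A @ B) = set W" using Cons.prems W' by auto
  then have ms: "mset (A @ B) = mset W"
    using Cons.prems(2) by (metis distinct.simps(2) set_eq_iff_mset_eq_distinct)
  have "f (P @ (c # W) @ Q @ (c # W) @ R) = f ((P @ [c]) @ W @ (Q @ [c]) @ W @ R)" by simp
  also have "\<dots> = f ((P @ [c]) @ (A @ B) @ (Q @ [c]) @ (A @ B) @ R)"
    using Cons.prems AB by (intro Cons.IH) simp_all
  also have "\<dots> = f (P @ c # A @ (B @ Q) @ c # A @ B @ R)" by simp
  also have "\<dots> = f (P @ A @ c # (B @ Q) @ A @ c # B @ R)"
  proof (rule chord_commutes_with_closed_pair(1)[OF f _ _ \<open>c \<noteq> s\<close>, symmetric])
    show "closed_word (A @ A)" using AB closed_word_doubled by auto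
    show "flat_word s V (c # c # P @ A @ (B @ Q) @ A @ B @ R)"
      using ms by (intro flat_word_perm[OF Cons.prems(1)]) (simp add: ac_simps, metis union_assoc union_commute)
  qed
  finally show ?case unfolding W' by simp
qed simp

section \<open>Crossings in two-strand diagrams\<close>

text \<open>
  The arc multiplicity from \<open>c\<close> to \<open>d\<close> on one strand, in a form suited to splitting words.
\<close>
fun arcs :: "nat list \<Rightarrow> nat \<Rightarrow> nat \<Rightarrow> nat" where
  "arcs [] c d = 0"
| "arcs (e # w) c d = (if e = c then count_list w d else 0) + arcs w c d"

definition crossing :: "nat list \<Rightarrow> nat list \<Rightarrow> nat \<Rightarrow> nat \<Rightarrow> bool" where
  "crossing A B c d \<longleftrightarrow> odd (arcs A c d + arcs B c d) \<and> odd (arcs A d c + arcs B d c)"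

definition two_strand :: "nat set \<Rightarrow> nat list \<Rightarrow> nat list \<Rightarrow> bool" where
  "two_strand V A B \<longleftrightarrow> (\<forall>c. count_list A c + count_list B c = (if c \<in> V then 2 else 0))"

lemma crossing_swap: "crossing B A c d = crossing A B c d"
  unfolding crossing_def by (simp add: add.commute)

lemma two_strand_swap: "two_strand V A B \<Longrightarrow> two_strand V B A"
  unfolding two_strand_def by (simp add: add.commute)

lemma arcs_append: "arcs (v @ w) c d = arcs v c d + arcs w c d + count_list v c * count_list w d"
  by (induction v) (simp_all add: count_list_append algebra_simps)

lemma arcs_absent: "c \<notin> set w \<or> d \<notin> set w \<Longrightarrow> arcs w c d = 0"
  by (induction w) (auto simp: count_notin)

lemma arcs_total: "c \<noteq> d \<Longrightarrow> arcs w c d + arcs w d c = count_list w c * count_list w d"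
  by (induction w) (auto simp: algebra_simps)

lemma count_list_filter_neq:
  "count_list (filter (\<lambda>e. e \<noteq> x) w) c = (if c = x then 0 else count_list w c)"
  by (induction w) auto

lemma arcs_filter_neq:
  "c \<noteq> x \<Longrightarrow> d \<noteq> x \<Longrightarrow> arcs (filter (\<lambda>e. e \<noteq> x) w) c d = arcs w c d"
  by (induction w) (auto simp: count_list_filter_neq)

lemma filter_neq_absent: "x \<notin> set w \<Longrightarrow> filter (\<lambda>e. e \<noteq> x) w = w"
  by (induction w) auto

lemma two_strand_set: "two_strand V A B \<Longrightarrow> set A \<union> set B = V"
  unfolding two_strand_def
  by (auto simp: count_list_0_iff split: if_splits)
    (metis add_is_0 count_list_0_iff zero_neq_numeral)+

lemma two_strand_flat_word: "two_strand V A B \<Longrightarrow> s \<notin> V \<Longrightarrow> flat_word s V (A @ s # B)"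
  unfolding two_strand_def flat_word_def by (auto simp: count_list_append)

lemma two_strand_remove:
  "two_strand V A B \<Longrightarrow> two_strand (V - {x}) (filter (\<lambda>e. e \<noteq> x) A) (filter (\<lambda>e. e \<noteq> x) B)"
  unfolding two_strand_def by (simp add: count_list_filter_neq) (metis add_is_0)

lemma crossing_remove:
  "c \<noteq> x \<Longrightarrow> d \<noteq> x \<Longrightarrow>
    crossing (filter (\<lambda>e. e \<noteq> x) A) (filter (\<lambda>e. e \<noteq> x) B) c d = crossing A B c d"
  unfolding crossing_def by (simp add: arcs_filter_neq)

lemma crossing_unmarked:
  assumes "x \<notin> set (P @ W @ Q @ B)" "c \<noteq> x"
  shows "crossing (P @ x # W @ x # Q) B x c \<longleftrightarrow> odd (count_list W c)"
  using assms unfolding crossing_def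
  by (auto simp: arcs_append arcs_absent count_notin count_list_append)

text \<open>
  The feet of \<open>x\<close> enclose exactly one foot of the chords that cross \<open>x\<close>, and both or no feet of the
  other chords.
\<close>
lemma unmarked_leaf_position:
  assumes D: "two_strand V A B" and x: "x \<in> V" "x \<notin> set B" and u: "u \<in> V" "u \<noteq> x"
    and leaf: "\<And>c. c \<in> V \<Longrightarrow> c \<noteq> x \<Longrightarrow> crossing A B x c \<longleftrightarrow> c = u"
  obtains P W1 W2 Q where "A = P @ x # W1 @ u # W2 @ x # Q" "closed_word (W1 @ W2)"
    "x \<notin> set (P @ W1 @ W2 @ Q)"
proof -
  have "count_list A x = 2" using D x unfolding two_strand_def by (metis add.right_neutral count_notin)
  then obtain P W Q where A: "A = P @ x # W @ x # Q" and n: "x \<notin> set P" "x \<notin> set W" "x \<notin> set Q"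
    using occurrence_pair by metis
  have odd: "odd (count_list W c) \<longleftrightarrow> c = u" if "c \<in> V" "c \<noteq> x" for c
    using leaf[OF that] crossing_unmarked[of x P W Q B c] n x that A by simp
  have le: "count_list W c \<le> 2" for c
  proof -
    have "count_list A c \<le> 2"
      using D unfolding two_strand_def by (metis le_add1 order.trans order_refl zero_le)
    then show ?thesis using A by (simp add: count_list_append split: if_splits)
  qed
  have Wu: "count_list W u = 1" using odd[OF u] le[of u] by (auto simp: le_Suc_eq numeral_2_eq_2)
  then have "u \<in> set W" by (metis count_list_0_iff zero_neq_one)
  then obtain W1 W2 where W: "W = W1 @ u # W2" by (meson split_list)
  have "closed_word (W1 @ W2)"
    unfolding closed_word_def
  proof
    fix c assume c: "c \<in> set (W1 @ W2)"
    have "c \<noteq> u" using Wu W c by (auto simp: count_list_append count_list_0_iff)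
    moreover have "c \<in> V" "c \<noteq> x" using c W A n two_strand_set[OF D] by auto
    ultimately have "even (count_list W c)" using odd by blast
    moreover have "count_list W c \<noteq> 0" using c W by (auto simp: count_list_0_iff)
    ultimately have "count_list W c = 2" using le[of c] by (auto simp: le_Suc_eq numeral_2_eq_2)
    then show "count_list (W1 @ W2) c = 2" using W \<open>c \<noteq> u\<close> by (simp add: count_list_append)
  qed
  then show ?thesis using that A W n by auto
qed

text \<open>
  The function on the right depends on the leaf, its neighbour and the strand of the leaf, but not on
  the arrangement of the diagram: so two diagrams with the same graph lose the leaf simultaneously.
\<close>
lemma remove_unmarked_leaf:
  assumes f: "four_term s V f" and D: "two_strand V A B" and s: "s \<notin> V"
    and x: "x \<in> V" "x \<notin> set A \<inter> set B" and u: "u \<in> V" "u \<noteq> x"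
    and leaf: "\<And>c. c \<in> V \<Longrightarrow> c \<noteq> x \<Longrightarrow> crossing A B x c \<longleftrightarrow> c = u"
  shows "f (A @ s # B)
    = leaf_removed f x u (x \<in> set A) (filter (\<lambda>e. e \<noteq> x) A @ s # filter (\<lambda>e. e \<noteq> x) B)"
proof -
  have us: "u \<noteq> s" and xs: "x \<noteq> s" using u x s by auto
  note w = two_strand_flat_word[OF D s]
  have sAB: "s \<notin> set A" "s \<notin> set B" using s two_strand_set[OF D] by auto
  have xx: "closed_word [x, x]" by (simp add: closed_word_def)
  consider "x \<notin> set B" | "x \<notin> set A" using x by auto
  then show ?thesis
  proof cases
    case 1
    obtain P W1 W2 Q where A: "A = P @ x # W1 @ u # W2 @ x # Q" and cl: "closed_word (W1 @ W2)"
      and n: "x \<notin> set (P @ W1 @ W2 @ Q)"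
      using unmarked_leaf_position[OF D x(1) 1 u leaf] by metis
    have fl: "filter (\<lambda>e. e \<noteq> x) A = P @ W1 @ u # W2 @ Q" "filter (\<lambda>e. e \<noteq> x) B = B"
      using A n 1 u by (simp_all add: filter_neq_absent)
    have "f (A @ s # B) = reduced_leaf f x u (P @ W1 @ u # W2 @ Q @ s # B)
        + f (P @ x # x # W1 @ u # W2 @ Q @ s # B)"
      using surrounding_leaf[OF f _ cl us xs, of P "Q @ s # B"] w A by simp
    moreover have "f (x # x # P @ W1 @ u # W2 @ Q @ s # B) = f (P @ x # x # W1 @ u # W2 @ Q @ s # B)"
      using closed_word_commutes[OF f flat_word_perm[OF w] xx, of "[]" P "W1 @ u # W2 @ Q @ s # B"] A sAB
      by (simp add: add_mset_commute ac_simps)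
    ultimately show ?thesis unfolding leaf_removed_def fl using A by simp
  next
    case 2
    have leaf': "\<And>c. c \<in> V \<Longrightarrow> c \<noteq> x \<Longrightarrow> crossing B A x c \<longleftrightarrow> c = u" using leaf by (simp add: crossing_swap)
    obtain P W1 W2 Q where B: "B = P @ x # W1 @ u # W2 @ x # Q" and cl: "closed_word (W1 @ W2)"
      and n: "x \<notin> set (P @ W1 @ W2 @ Q)"
      using unmarked_leaf_position[OF two_strand_swap[OF D] x(1) 2 u leaf'] by metis
    have fl: "filter (\<lambda>e. e \<noteq> x) B = P @ W1 @ u # W2 @ Q" "filter (\<lambda>e. e \<noteq> x) A = A"
      using B n 2 u by (simp_all add: filter_neq_absent)
    have "f (A @ s # B) = reduced_leaf f x u (A @ s # P @ W1 @ u # W2 @ Q)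
        + f (A @ s # P @ x # x # W1 @ u # W2 @ Q)"
      using surrounding_leaf[OF f _ cl us xs, of "A @ s # P" Q] w B by simp
    moreover have "f (A @ s # P @ x # x # W1 @ u # W2 @ Q) = f (A @ s # P @ W1 @ u # W2 @ Q @ [x, x])"
      using closed_word_commutes[OF f flat_word_perm[OF w] xx, of "A @ s # P" "W1 @ u # W2 @ Q" "[]"] B sAB us
      by (simp add: add_mset_commute ac_simps)
    ultimately show ?thesis unfolding leaf_removed_def fl using 2 by simp
  qed
qed

section \<open>Stars of marked chords\<close>

lemma distinct_if_counts: "(\<And>c. count_list w c \<le> 1) \<Longrightarrow> distinct w"
proof (induction w)
  case (Cons a w)
  have "count_list w c \<le> 1" for c using Cons.prems[of c] by (simp split: if_splits)
  moreover have "a \<notin> set w" using Cons.prems[of a] by (simp add: count_list_0_iff)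
  ultimately show ?case using Cons.IH by simp
qed simp

lemma le_1_count: "(c \<in> set w \<Longrightarrow> count_list w c = 1) \<Longrightarrow> count_list w c \<le> 1"
  by (cases "c \<in> set w") (simp_all add: count_notin)

lemma same_order_eq:
  assumes "distinct W" "distinct W'" "set W' = set W"
    and "\<And>c d. c \<in> set W \<Longrightarrow> d \<in> set W \<Longrightarrow> c \<noteq> d \<Longrightarrow> arcs W c d = arcs W' c d"
  shows "W = W'"
  using assms
proof (induction W arbitrary: W')
  case (Cons a W)
  from Cons.prems(3) obtain b W0 where W': "W' = b # W0" by (cases W') auto
  have "a = b"
  proof (rule ccontr)
    assume ab: "a \<noteq> b"
    have "b \<in> set W" using Cons.prems(3) W' ab by auto
    then have "arcs (a # W) a b \<noteq> 0" by (simp add: count_list_0_iff)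
    moreover have "arcs W' a b = 0" using W' ab Cons.prems(2) by (simp add: arcs_absent)
    ultimately show False using Cons.prems(4)[of a b] ab \<open>b \<in> set W\<close> by simp
  qed
  moreover have "W = W0"
  proof (rule Cons.IH)
    show "set W0 = set W" using Cons.prems(1-3) W' \<open>a = b\<close> by auto
    show "arcs W c d = arcs W0 c d" if "c \<in> set W" "d \<in> set W" "c \<noteq> d" for c d
      using Cons.prems(4)[of c d] Cons.prems(1) that W' \<open>a = b\<close> by (auto split: if_splits)
  qed (use Cons.prems W' in auto)
  ultimately show ?case using W' by simp
qed simp

lemma not_crossing_marked:
  assumes "count_list A c = 1" "count_list A d = 1" "count_list B c = 1" "count_list B d = 1"
    and "c \<noteq> d" "\<not> crossing A B c d"
  shows "arcs A c d = arcs B c d"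
proof -
  have "arcs A c d + arcs A d c = 1" "arcs B c d + arcs B d c = 1"
    using assms arcs_total[of c d] by simp_all
  then have "arcs A c d = 0 \<and> arcs A d c = 1 \<or> arcs A c d = 1 \<and> arcs A d c = 0"
    "arcs B c d = 0 \<and> arcs B d c = 1 \<or> arcs B c d = 1 \<and> arcs B d c = 0"
    by linarith+
  then show ?thesis using assms(6) unfolding crossing_def by auto
qed

text \<open>
  A standard drawing of the star with trunk \<open>v\<close> and marked children \<open>W\<close>.  The flags say which strands
  carry \<open>v\<close>; at least one does.
\<close>
definition marked_star :: "nat \<Rightarrow> nat \<Rightarrow> bool \<Rightarrow> bool \<Rightarrow> nat list \<Rightarrow> nat list" where
  "marked_star s v left right W =
    (if left \<and> right then W @ [v, s, v] @ W
     else if left then [v] @ W @ [v, s] @ W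
     else W @ [s, v] @ W @ [v])"

lemma star_around_unmarked:
  assumes D: "two_strand V A B" and v: "v \<in> V" "v \<notin> set B"
    and star: "\<And>c. c \<in> V - {v} \<Longrightarrow> c \<in> set A \<and> c \<in> set B \<and> crossing A B v c"
    and par: "\<And>c d. c \<in> V - {v} \<Longrightarrow> d \<in> V - {v} \<Longrightarrow> c \<noteq> d \<Longrightarrow> \<not> crossing A B c d"
  shows "A = [v] @ B @ [v] \<and> distinct B \<and> set B = V - {v}"
proof -
  have one: "count_list A c = 1 \<and> count_list B c = 1" if "c \<in> V - {v}" for c
  proof -
    have "count_list A c \<noteq> 0" "count_list B c \<noteq> 0" using star[OF that] by (simp_all add: count_list_0_iff)
    moreover have "count_list A c + count_list B c = 2" using D that unfolding two_strand_def by auto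
    ultimately show ?thesis by linarith
  qed
  have "count_list A v = 2" using D v unfolding two_strand_def by (metis add.right_neutral count_notin)
  then obtain P W Q where A: "A = P @ v # W @ v # Q" and n: "v \<notin> set P" "v \<notin> set W" "v \<notin> set Q"
    using occurrence_pair by metis
  have inW: "count_list W c = 1 \<and> c \<in> set W \<and> c \<notin> set P \<and> c \<notin> set Q" if c: "c \<in> V - {v}" for c
  proof -
    have "odd (count_list W c)"
      using star[OF c] crossing_unmarked[of v P W Q B c] n v c A by simp
    then have "count_list W c > 0" by (rule odd_pos)
    moreover have "count_list P c + count_list W c + count_list Q c = 1"
      using one[OF c] c A by (simp add: count_list_append)
    ultimately have "count_list W c = 1" "count_list P c = 0" "count_list Q c = 0" by linarith+
    then show ?thesis by (metis count_list_0_iff zero_neq_one)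
  qed
  have sub: "set P \<subseteq> V - {v}" "set Q \<subseteq> V - {v}" "set W \<subseteq> V - {v}" "set B \<subseteq> V - {v}"
    using two_strand_set[OF D] A n v by auto
  have PQ: "P = []" "Q = []" using inW sub by (cases P; cases Q; auto)+
  have sets: "set W = V - {v}" "set B = V - {v}"
    using sub inW star by blast+
  have dist: "distinct W" "distinct B"
    using inW one sets by (auto intro!: distinct_if_counts le_1_count)
  have "W = B"
  proof (rule same_order_eq[OF dist])
    fix c d assume c: "c \<in> set W" and d: "d \<in> set W" and cd: "c \<noteq> d"
    have "arcs A c d = arcs B c d"
      using not_crossing_marked one par c d cd sets by metis
    moreover have "arcs A c d = arcs W c d"
      using A PQ c d sets by (simp add: arcs_append)
    ultimately show "arcs W c d = arcs B c d" by simp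
  qed (use sets in auto)
  then show ?thesis using A PQ dist sets by simp
qed

text \<open>
  A marked child crosses the marked trunk when it lies below it on one strand and above it on the
  other.  Children of the two possible kinds would cross each other, so all are of the same kind.
\<close>
lemma star_around_marked:
  assumes D: "two_strand V A B" and v: "v \<in> set A" "v \<in> set B"
    and star: "\<And>c. c \<in> V - {v} \<Longrightarrow> c \<in> set A \<and> c \<in> set B \<and> crossing A B v c"
    and par: "\<And>c d. c \<in> V - {v} \<Longrightarrow> d \<in> V - {v} \<Longrightarrow> c \<noteq> d \<Longrightarrow> \<not> crossing A B c d"
  shows "\<exists>W. distinct W \<and> set W = V - {v} \<and> (A = W @ [v] \<and> B = v # W \<or> A = v # W \<and> B = W @ [v])"
proof -
  have V: "set A \<union> set B = V" by (rule two_strand_set[OF D])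
  have one: "count_list A c = 1 \<and> count_list B c = 1" if "c \<in> V" for c
  proof -
    have "count_list A c \<noteq> 0" "count_list B c \<noteq> 0" using star that v by (auto simp: count_list_0_iff)
    moreover have "count_list A c + count_list B c = 2" using D that unfolding two_strand_def by auto
    ultimately show ?thesis by linarith
  qed
  have dist: "distinct A" "distinct B"
    using one V by (auto intro!: distinct_if_counts le_1_count)
  obtain A1 A2 B1 B2 where A: "A = A1 @ v # A2" and B: "B = B1 @ v # B2" using v by (meson split_list)
  have side: "c \<in> set A1 \<longleftrightarrow> c \<in> set B2" if c: "c \<in> V - {v}" for c
  proof -
    have "odd (arcs A c v + arcs B c v)" using star[OF c] unfolding crossing_def by simp
    moreover have "arcs A c v = count_list A1 c" "arcs B c v = count_list B1 c"
      using A B c dist by (simp_all add: arcs_append arcs_absent)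
    moreover have "count_list A1 c + count_list A2 c = 1" "count_list B1 c + count_list B2 c = 1"
      using one[of c] c A B by (auto simp: count_list_append)
    ultimately have "count_list A1 c = 1 \<and> count_list B2 c = 1 \<or> count_list A1 c = 0 \<and> count_list B2 c = 0"
      by (auto simp: add_is_1)
    then show ?thesis by (metis count_list_0_iff zero_neq_one)
  qed
  have sA: "set A1 \<union> set A2 = V - {v}" "set B1 \<union> set B2 = V - {v}"
    using A B dist V star by auto
  have "A1 = [] \<or> A2 = []"
  proof (rule ccontr)
    assume "\<not> (A1 = [] \<or> A2 = [])"
    then obtain c d where c: "c \<in> set A1" and d: "d \<in> set A2" by (meson ex_in_conv set_empty)
    have cd: "c \<noteq> d" "c \<in> V - {v}" "d \<in> V - {v}" using c d A dist sA by auto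
    have "c \<in> set B2" "d \<in> set B1" using side cd c d A B dist sA by auto
    moreover from this have "c \<notin> set A2" "d \<notin> set A1" "c \<notin> set B1" "d \<notin> set B2"
      using c d A B dist by auto
    ultimately have "arcs A d c = 0" "arcs B c d = 0"
      using cd A B by (simp_all add: arcs_append arcs_absent)
    then show False using not_crossing_marked[of A c d B] par cd one arcs_total[of c d A] by simp
  qed
  moreover have same: "arcs A c d = arcs B c d" if "c \<in> V - {v}" "d \<in> V - {v}" "c \<noteq> d" for c d
    using that one par by (intro not_crossing_marked) auto
  ultimately consider "A2 = []" | "A1 = []" by auto
  then show ?thesis
  proof cases
    case 1
    have "c \<notin> set B1" for c
    proof
      assume c: "c \<in> set B1"
      then have "c \<in> V - {v}" using sA by blast
      then have "c \<in> set B2" using sA(1) side 1 by auto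
      then show False using c B dist by auto
    qed
    then have B1: "B1 = []" by (cases B1) auto
    have "A1 = B2"
    proof (rule same_order_eq)
      show "arcs A1 c d = arcs B2 c d" if "c \<in> set A1" "d \<in> set A1" "c \<noteq> d" for c d
        using same[of c d] that sA A B 1 B1 by (auto simp: arcs_append)
    qed (use A B dist sA 1 B1 in auto)
    then show ?thesis using A B 1 B1 dist sA by auto
  next
    case 2
    have "c \<notin> set B2" for c using sA side 2 B dist by auto
    then have B2: "B2 = []" by (cases B2) auto
    have "A2 = B1"
    proof (rule same_order_eq)
      show "arcs A2 c d = arcs B1 c d" if "c \<in> set A2" "d \<in> set A2" "c \<noteq> d" for c d
        using same[of c d] that sA A B 2 B2 by (auto simp: arcs_append)
    qed (use A B dist sA 2 B2 in auto)
    then show ?thesis using A B 2 B2 dist sA by auto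
  qed
qed

text \<open>
  Drawings of a star of marked chords differ by the order of the children and, if the trunk is marked,
  by the side on which the children pass it.
\<close>
lemma star_value:
  assumes f: "four_term s V f" and D: "two_strand V A B" and s: "s \<notin> V" and v: "v \<in> V"
    and star: "\<And>c. c \<in> V - {v} \<Longrightarrow> c \<in> set A \<and> c \<in> set B \<and> crossing A B v c"
    and par: "\<And>c d. c \<in> V - {v} \<Longrightarrow> d \<in> V - {v} \<Longrightarrow> c \<noteq> d \<Longrightarrow> \<not> crossing A B c d"
    and W: "distinct W" "set W = V - {v}"
  shows "f (A @ s # B) = f (marked_star s v (v \<in> set A) (v \<in> set B) W)"
proof -
  note w = two_strand_flat_word[OF D s]
  have sW: "s \<notin> set W" and vs: "v \<noteq> s" using W s v by auto
  note perm = parallel_chords_permute[OF f]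
  have "v \<in> set A \<union> set B" using v two_strand_set[OF D] by auto
  then consider "v \<notin> set B" "v \<in> set A" | "v \<notin> set A" "v \<in> set B" | "v \<in> set A" "v \<in> set B" by auto
  then show ?thesis
  proof cases
    case 1
    have "A = [v] @ B @ [v] \<and> distinct B \<and> set B = V - {v}"
      by (rule star_around_unmarked[OF D v 1(1) star par])
    then show ?thesis using perm[of "[v]" B "[v, s]" "[]" W] w W sW 1
      by (simp add: marked_star_def)
  next
    case 2
    have "B = [v] @ A @ [v] \<and> distinct A \<and> set A = V - {v}"
      by (rule star_around_unmarked[OF two_strand_swap[OF D] v 2(1)])
        (use star par crossing_swap in blast)+
    then show ?thesis using perm[of "[]" A "[s, v]" "[v]" W] w W sW 2
      by (simp add: marked_star_def)
  next
    case 3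
    obtain U where U: "distinct U" "set U = V - {v}"
      and AB: "A = U @ [v] \<and> B = v # U \<or> A = v # U \<and> B = U @ [v]"
      using star_around_marked[OF D 3 star par] by blast
    have wU: "flat_word s V (v # v # [] @ U @ [s] @ U @ [])"
      using AB by (intro flat_word_perm[OF w]) auto
    \<comment> \<open>The two sides differ by moving both feet of the trunk past the closed pair of the children.\<close>
    have "f (A @ s # B) = f (U @ [v, s, v] @ U)"
      using AB chord_commutes_with_closed_pair(2)[OF f wU closed_word_doubled[OF U(1)] vs] by auto
    also have "\<dots> = f (W @ [v, s, v] @ W)"
      using perm[of "[]" U "[v, s, v]" "[]" W] U W sW flat_word_perm[OF wU] by simp
    finally show ?thesis using 3 by (simp add: marked_star_def)
  qed
qed

section \<open>Leaves of rooted trees\<close>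

text \<open>
  A longest path from the root ends at a leaf.  If the path has an edge beyond the neighbours of the
  root, then its end is not adjacent to the root and hence unmarked; otherwise the tree is a star, and
  an unmarked vertex of a star other than its centre is a leaf.
\<close>
lemma leaf_or_star:
  assumes fin: "finite V" and v: "v \<in> V"
    and conn: "\<And>y. y \<in> V \<Longrightarrow> (v, y) \<in> (adjacency_within E V)\<^sup>*"
    and acyc: "\<nexists>vs. graph_cycle V E vs"
    and loop: "\<And>c. {c} \<notin> E"
    and M: "\<And>c. c \<in> V - {v} \<Longrightarrow> M c \<Longrightarrow> {v, c} \<in> E"
  obtains (star) "\<And>c. c \<in> V - {v} \<Longrightarrow> M c \<and> {v, c} \<in> E"
      "\<And>c d. c \<in> V - {v} \<Longrightarrow> d \<in> V - {v} \<Longrightarrow> {c, d} \<notin> E"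
  | (leaf) x u where "x \<in> V - {v}" "\<not> M x" "u \<in> V - {x}" "\<And>c. c \<in> V \<Longrightarrow> {x, c} \<in> E \<longleftrightarrow> c = u"
proof -
  \<comment> \<open>Paths are listed from their far end to the root.\<close>
  define path where "path q \<longleftrightarrow> q \<noteq> [] \<and> distinct q \<and> set q \<subseteq> V \<and>
    successively (\<lambda>a b. {a, b} \<in> E) q \<and> last q = v" for q
  have start: "path [v]" using v by (simp add: path_def)
  have bound: "\<forall>q. path q \<longrightarrow> length q < Suc (card V)"
    unfolding path_def using fin by (metis card_mono distinct_card le_imp_less_Suc)
  from ex_has_greatest_nat[OF start bound]
  obtain q where q: "path q" and "\<forall>p. path p \<longrightarrow> length p \<le> length q" by (elim exE conjE)
  then have max: "\<And>p. path p \<Longrightarrow> length p \<le> length q" by simp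
  show thesis
  proof (cases "length q \<le> 2")
    case True
    have short: "length p \<le> 2" if "path p" for p using max[OF that] True by linarith
    have no_edge: "{c, d} \<notin> E" if c: "c \<in> V - {v}" "d \<in> V - {v}" "{v, c} \<in> E" for c d
    proof
      assume e: "{c, d} \<in> E"
      have "c \<noteq> d" using e loop by auto
      then have "path [d, c, v]" using c v e by (auto simp: path_def insert_commute)
      then show False using short by fastforce
    qed
    have adj: "{v, y} \<in> E" if y: "y \<in> V - {v}" for y
    proof -
      have "(v, y) \<in> (adjacency_within E V)\<^sup>*" using conn y by blast
      then have "y \<noteq> v \<longrightarrow> {v, y} \<in> E"
      proof (induction rule: rtrancl_induct)
        case (step y z)
        then show ?case
          using no_edge[of y z] unfolding adjacency_within_def by (cases "y = v") auto
      qed simp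
      then show ?thesis using y by simp
    qed
    show thesis
    proof (cases "\<exists>x \<in> V - {v}. \<not> M x")
      case True
      then obtain x where x: "x \<in> V - {v}" "\<not> M x" by blast
      show thesis
      proof (rule leaf[OF x])
        show "v \<in> V - {x}" using x v by auto
        show "{x, c} \<in> E \<longleftrightarrow> c = v" if "c \<in> V" for c
          using that adj x no_edge by (metis DiffI insert_commute singletonD)
      qed
    next
      case False
      show thesis
      proof (rule star)
        show "M c \<and> {v, c} \<in> E" if "c \<in> V - {v}" for c using adj False that by blast
        show "{c, d} \<notin> E" if "c \<in> V - {v}" "d \<in> V - {v}" for c d
          using adj no_edge that by blast
      qed
    qed
  next
    case False
    then obtain x u r where qr: "q = x # u # r" "r \<noteq> []"
      by (cases q; cases "tl q") auto
    have x: "x \<in> V - {v}" "u \<in> V - {x}" "{x, u} \<in> E" "v \<in> set r"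
      using q qr unfolding path_def by (auto simp: last_in_set)
    have only: "c = u" if c: "c \<in> V" "{x, c} \<in> E" for c
    proof (rule ccontr)
      assume cu: "c \<noteq> u"
      have cx: "c \<noteq> x" using c loop by auto
      show False
      proof (cases "c \<in> set r")
        case True
        then obtain r1 r2 where r: "r = r1 @ c # r2" by (meson split_list)
        have "q = (x # u # r1 @ [c]) @ r2" using qr r by simp
        then have "successively (\<lambda>a b. {a, b} \<in> E) (x # u # r1 @ [c])"
          "distinct (x # u # r1 @ [c])" "set (x # u # r1 @ [c]) \<subseteq> V"
          using q unfolding path_def by (auto simp only: successively_append_iff distinct_append set_append)
        then have "graph_cycle V E (x # u # r1 @ [c])"
          using c(2) unfolding graph_cycle_def by (simp add: insert_commute)
        then show False using acyc by blast
      next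
        case False
        then have "path (c # q)" using q qr c cx cu unfolding path_def by (auto simp: insert_commute)
        then show False using max by fastforce
      qed
    qed
    show thesis
    proof (rule leaf[OF x(1) _ x(2)])
      show "\<not> M x"
      proof
        assume "M x"
        then have "v = u" using M[OF x(1)] only v by (simp add: insert_commute)
        then show False using q qr x unfolding path_def by auto
      qed
      show "{x, c} \<in> E \<longleftrightarrow> c = u" if "c \<in> V" for c using only that x by blast
    qed
  qed
qed

text \<open>
  A walk that enters a leaf has to leave through its neighbour.  The induction records the last vertex
  of the walk that differs from the leaf, which is the neighbour whenever the walk has stopped at the
  leaf.
\<close>
lemma connected_without_leaf:
  assumes "(v, y) \<in> (adjacency_within E V)\<^sup>*" and "v \<noteq> x" "u \<noteq> x"
    and leaf: "\<And>c. c \<in> V \<Longrightarrow> {x, c} \<in> E \<longleftrightarrow> c = u"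
  shows "(v, if y = x then u else y) \<in> (adjacency_within E (V - {x}))\<^sup>*"
  using assms(1)
proof (induction rule: rtrancl_induct)
  case base
  then show ?case using assms(2) by simp
next
  case (step y z)
  then have e: "y \<in> V" "z \<in> V" "{y, z} \<in> E" unfolding adjacency_within_def by auto
  show ?case
  proof (cases "y = x \<or> z = x")
    case True
    then have "(if y = x then u else y) = (if z = x then u else z)"
      using leaf e assms(3) by (metis insert_commute)
    then show ?thesis using step.IH by simp
  next
    case False
    then have "(y, z) \<in> adjacency_within E (V - {x})" using e unfolding adjacency_within_def by simp
    then show ?thesis using step.IH False by (simp add: rtrancl.rtrancl_into_rtrancl)
  qed
qed

section \<open>Trimmed trees determine the value\<close>

text \<open>
  Induction on the number of chords, for all functions \<open>f\<close> at once.  The two diagrams use the same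
  names, so that their graphs are equal and not only isomorphic.
\<close>
lemma trimmed_tree_determines_value:
  assumes "finite V" and "four_term s V f" and "s \<notin> V" and "v \<in> V"
    and "two_strand V A B" and "two_strand V A' B'"
    and "set A' = set A" and "set B' = set B"
    and "\<And>c d. c \<in> V \<Longrightarrow> d \<in> V \<Longrightarrow> c \<noteq> d \<Longrightarrow> crossing A B c d \<longleftrightarrow> {c, d} \<in> E"
    and "\<And>c d. c \<in> V \<Longrightarrow> d \<in> V \<Longrightarrow> c \<noteq> d \<Longrightarrow> crossing A' B' c d \<longleftrightarrow> {c, d} \<in> E"
    and "\<And>c. {c} \<notin> E"
    and "\<And>y. y \<in> V \<Longrightarrow> (v, y) \<in> (adjacency_within E V)\<^sup>*"
    and "\<nexists>vs. graph_cycle V E vs"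
    and "\<And>c. c \<in> V - {v} \<Longrightarrow> c \<in> set A \<inter> set B \<Longrightarrow> {v, c} \<in> E"
  shows "f (A @ s # B) = f (A' @ s # B')"
  using assms
proof (induction V arbitrary: f A B A' B' rule: finite_psubset_induct)
  case (psubset V)
  note f = psubset.prems(1) and s = psubset.prems(2) and v = psubset.prems(3)
    and D = psubset.prems(4) and D' = psubset.prems(5)
    and sets = psubset.prems(6,7) and E = psubset.prems(8) and E' = psubset.prems(9)
    and loop = psubset.prems(10) and conn = psubset.prems(11) and acyc = psubset.prems(12)
    and M = psubset.prems(13)
  show ?case
  proof (rule leaf_or_star[of V v E "\<lambda>c. c \<in> set A \<inter> set B", OF psubset.hyps(1) v conn acyc loop M])
    assume star: "\<And>c. c \<in> V - {v} \<Longrightarrow> c \<in> set A \<inter> set B \<and> {v, c} \<in> E"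
      "\<And>c d. c \<in> V - {v} \<Longrightarrow> d \<in> V - {v} \<Longrightarrow> {c, d} \<notin> E"
    obtain W where W: "distinct W" "set W = V - {v}"
      using psubset.hyps(1) finite_distinct_list by (metis finite_Diff)
    have "f (A @ s # B) = f (marked_star s v (v \<in> set A) (v \<in> set B) W)"
      by (rule star_value[OF f D s v _ _ W]) (use star E v in auto)
    moreover have "f (A' @ s # B') = f (marked_star s v (v \<in> set A') (v \<in> set B') W)"
      by (rule star_value[OF f D' s v _ _ W]) (use star E' v sets in auto)
    ultimately show ?thesis using sets by simp
  next
    fix x u
    assume leaf: "x \<in> V - {v}" "x \<notin> set A \<inter> set B" "u \<in> V - {x}"
      "\<And>c. c \<in> V \<Longrightarrow> {x, c} \<in> E \<longleftrightarrow> c = u"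
    define del where "del = filter (\<lambda>e. e \<noteq> x)"
    define g where "g = leaf_removed f x u (x \<in> set A)"
    have x: "x \<in> V" "x \<notin> set A \<inter> set B" and u: "u \<in> V" "u \<noteq> x" using leaf by auto
    have V: "insert x (V - {x}) = V" using x by auto
    have "f (A @ s # B) = g (del A @ s # del B)"
      unfolding g_def del_def
      by (rule remove_unmarked_leaf[OF f D s x u]) (use E leaf(4) x in auto)
    moreover have "f (A' @ s # B') = g (del A' @ s # del B')"
      unfolding g_def del_def sets(1)[symmetric]
      by (rule remove_unmarked_leaf[OF f D' s x(1) _ u]) (use E' leaf(4) x sets in auto)
    moreover have "g (del A @ s # del B) = g (del A' @ s # del B')"
    proof (rule psubset.IH)
      show "V - {x} \<subset> V" using x by auto
      show "four_term s (V - {x}) g"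
        unfolding g_def
        by (rule four_term_leaf_removed) (use f V s x u in auto)
      show "s \<notin> V - {x}" "v \<in> V - {x}" using s v leaf by auto
      show "two_strand (V - {x}) (del A) (del B)" "two_strand (V - {x}) (del A') (del B')"
        unfolding del_def by (rule two_strand_remove[OF D] two_strand_remove[OF D'])+
      show "set (del A') = set (del A)" "set (del B') = set (del B)"
        unfolding del_def using sets by auto
      show "crossing (del A) (del B) c d \<longleftrightarrow> {c, d} \<in> E"
        if "c \<in> V - {x}" "d \<in> V - {x}" "c \<noteq> d" for c d
        using that E unfolding del_def by (simp add: crossing_remove)
      show "crossing (del A') (del B') c d \<longleftrightarrow> {c, d} \<in> E"
        if "c \<in> V - {x}" "d \<in> V - {x}" "c \<noteq> d" for c d
        using that E' unfolding del_def by (simp add: crossing_remove)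
      show "{c} \<notin> E" for c by (rule loop)
      show "(v, y) \<in> (adjacency_within E (V - {x}))\<^sup>*" if "y \<in> V - {x}" for y
        using connected_without_leaf[OF conn[of y] _ u(2) leaf(4)] that leaf(1) by auto
      show "\<nexists>vs. graph_cycle (V - {x}) E vs"
        using acyc unfolding graph_cycle_def by blast
      show "{v, c} \<in> E" if "c \<in> V - {x} - {v}" "c \<in> set (del A) \<inter> set (del B)" for c
        using M that unfolding del_def by auto
    qed
    ultimately show ?thesis by simp
  qed
qed

section \<open>From weights on flat words to the relators\<close>

definition unflatten :: "nat \<Rightarrow> nat list \<Rightarrow> diagram" where
  "unflatten s Y = [takeWhile (\<lambda>c. c \<noteq> s) Y, tl (dropWhile (\<lambda>c. c \<noteq> s) Y)]"

lemma unflatten_eq: "s \<notin> set L \<Longrightarrow> unflatten s (L @ s # R) = [L, R]"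
  unfolding unflatten_def by (auto simp: takeWhile_append dropWhile_append)

lemma flat_word_chord_diagram:
  assumes "flat_word s V Y"
  shows "chord_diagram 2 (unflatten s Y)"
proof -
  have "count_list Y s = 1" using assms unfolding flat_word_def by simp
  then have "s \<in> set Y" by (metis count_list_0_iff zero_neq_one)
  then obtain L R where Y: "Y = L @ s # R" and n: "s \<notin> set L" by (meson split_list_first)
  have "s \<notin> set R" using \<open>count_list Y s = 1\<close> Y n by (simp add: count_list_0_iff)
  show ?thesis
    unfolding Y unflatten_eq[OF n] chord_diagram_def chords_def
  proof (intro conjI ballI)
    fix c assume "c \<in> set (concat [L, R])"
    then have c: "c \<noteq> s" "count_list Y c \<noteq> 0" using n \<open>s \<notin> set R\<close> Y by (auto simp: count_list_0_iff)
    then have "count_list Y c = 2" using assms unfolding flat_word_def by (metis (no_types))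
    then show "count_list (concat [L, R]) c = 2" using Y c by simp
  qed simp
qed

text \<open>
  The frame arises from the flat word by marking the fixed foot of \<open>b\<close> as the arc \<open>Gamma\<close> and cutting at
  the gap.
\<close>
lemma four_term_of_functional:
  fixes \<phi> :: "diagram_space \<Rightarrow> real"
  assumes lin: "linear \<phi>" and zero: "\<And>r. r \<in> four_term_relators 2 \<Longrightarrow> \<phi> r = 0"
  shows "four_term s V (\<lambda>Y. \<phi> (diagram_vector (unflatten s Y)))"
  unfolding four_term_def
proof (intro allI impI)
  fix A B C a b
  assume b: "b \<noteq> s" and w: "flat_word s V (b # A @ a # B @ a # C)"
  have cnt: "count_list (b # A @ a # B @ a # C) c = (if c = s then 1 else if c \<in> V then 2 else 0)" for c
    using w unfolding flat_word_def by blast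
  have as: "a \<noteq> s" using cnt[of a] by (auto split: if_splits)
  have ab: "a \<noteq> b" using cnt[of a] by (auto split: if_splits)
  have b1: "count_list A b + count_list B b + count_list C b = 1"
    using cnt[of b] b ab by (simp split: if_splits)
  define site_of where "site_of c = (if c = b then Gamma else Endpoint c)" for c
  define Z where "Z = map site_of A @ Alpha # map site_of B @ Beta # map site_of C"
  have fill: "concat (map (fill_site u v [b]) Z) = A @ u @ B @ v @ C" for u v
  proof -
    have "concat (map (fill_site u v [b]) (map site_of X)) = X" for X
      by (induction X) (auto simp: site_of_def)
    then show ?thesis unfolding Z_def by simp
  qed
  have gamma: "count_list (map site_of X) Gamma = count_list X b"
    and alpha: "count_list (map site_of X) Alpha = 0"
    and beta: "count_list (map site_of X) Beta = 0" for X
    by (induction X) (auto simp: site_of_def)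
  have "count_list A s + count_list B s + count_list C s = 1" using cnt[of s] as b by simp
  then have "s \<in> set A \<or> s \<in> set B \<or> s \<in> set C" by (metis add_0 count_notin zero_neq_one)
  moreover have "Endpoint s = site_of s" using b by (simp add: site_of_def)
  ultimately have "Endpoint s \<in> set Z" unfolding Z_def by auto
  then obtain Z1 Z2 where Z: "Z = Z1 @ Endpoint s # Z2" and n: "Endpoint s \<notin> set Z1"
    by (meson split_list_first)
  define F where "F = [Z1, Z2]"
  have counts: "count_list (concat F) Alpha = 1" "count_list (concat F) Beta = 1"
    "count_list (concat F) Gamma = 1"
  proof -
    have "count_list (concat F) e = count_list Z e" if "e \<noteq> Endpoint s" for e
      using that unfolding F_def Z by simp
    then show "count_list (concat F) Alpha = 1" "count_list (concat F) Beta = 1"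
      "count_list (concat F) Gamma = 1"
      unfolding Z_def using b1 by (simp_all add: alpha beta gamma)
  qed
  have frame: "fill_frame F u v [b] = unflatten s (A @ u @ B @ v @ C)"
    if "s \<notin> set u" "s \<notin> set v" for u v
  proof -
    let ?g = "\<lambda>X. concat (map (fill_site u v [b]) X)"
    have "s \<notin> set (fill_site u v [b] e)" if "e \<in> set Z1" for e
      using \<open>s \<notin> set u\<close> \<open>s \<notin> set v\<close> b n that by (cases e) auto
    then have "s \<notin> set (?g Z1)" by auto
    moreover have "A @ u @ B @ v @ C = ?g Z1 @ s # ?g Z2"
      unfolding fill[symmetric] Z by simp
    ultimately show ?thesis unfolding F_def fill_frame_def by (simp add: unflatten_eq)
  qed
  have "chord_diagram 2 (fill_frame F [a, b] [a] [b])"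
    using frame[of "[a, b]" "[a]"] as b
    by (simp add: flat_word_chord_diagram[OF flat_word_perm[OF w]])
  then have "diagram_vector (fill_frame F [a, b] [a] [b]) - diagram_vector (fill_frame F [b, a] [a] [b])
     + diagram_vector (fill_frame F [a] [a, b] [b]) - diagram_vector (fill_frame F [a] [b, a] [b])
     \<in> four_term_relators 2"
    unfolding four_term_relators_def using counts ab by blast
  from zero[OF this]
  show "\<phi> (diagram_vector (unflatten s (A @ a # b # B @ a # C)))
      - \<phi> (diagram_vector (unflatten s (A @ b # a # B @ a # C)))
      + \<phi> (diagram_vector (unflatten s (A @ a # B @ a # b # C)))
      - \<phi> (diagram_vector (unflatten s (A @ a # B @ b # a # C))) = 0"
    using as b by (simp add: frame linear_diff[OF lin] linear_add[OF lin])
qed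

lemma in_span_if_functionals_vanish:
  fixes x :: "'a::real_vector"
  assumes "\<And>\<phi> :: 'a \<Rightarrow> real. linear \<phi> \<Longrightarrow> (\<And>y. y \<in> S \<Longrightarrow> \<phi> y = 0) \<Longrightarrow> \<phi> x = 0"
  shows "x \<in> span S"
proof (rule ccontr)
  assume x: "x \<notin> span S"
  obtain B where B: "B \<subseteq> S" "independent B" "S \<subseteq> span B"
    using maximal_independent_subset[of S] by blast
  have xB: "x \<notin> span B" using x B(1) span_mono by blast
  then have "independent (insert x B)" using B(2) by (simp add: independent_insert)
  then obtain \<phi> :: "'a \<Rightarrow> real" where \<phi>: "linear \<phi>"
    "\<forall>y \<in> insert x B. \<phi> y = (if y = x then 1 else 0)"
    using linear_independent_extend[of "insert x B" "\<lambda>y. if y = x then 1 else 0"] by blast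
  have "\<phi> y = 0" if "y \<in> S" for y
  proof (rule linear_eq_0_on_span[OF \<phi>(1)])
    show "y \<in> span B" using that B(3) by blast
    show "\<phi> z = 0" if "z \<in> B" for z using \<phi>(2) that xB span_base by auto
  qed
  then show False using assms[OF \<phi>(1)] \<phi>(2) by simp
qed

section \<open>Intersection graphs of two-strand diagrams\<close>

lemma card_ordered_positions:
  assumes cd: "c \<noteq> d"
  shows "card {(p, q). p < q \<and> q < length w \<and> w ! p = c \<and> w ! q = d} = arcs w c d"
    (is "card (?S w) = _")
proof (induction w rule: rev_induct)
  case (snoc e w)
  let ?N = "if e = d then (\<lambda>p. (p, length w)) ` {p. p < length w \<and> w ! p = c} else {}"
  have "?S (w @ [e]) = ?S w \<union> ?N"
    using cd by (auto simp: nth_append less_Suc_eq split: if_splits)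
  moreover have "finite (?S w)" by (rule finite_subset[of _ "{..<length w} \<times> {..<length w}"]) auto
  moreover have "?S w \<inter> ?N = {}" by auto
  moreover have "card ?N = (if e = d then count_list w c else 0)"
    by (auto simp: card_image inj_on_def count_list_eq_length_filter length_filter_conv_card
        intro!: arg_cong[of _ _ card])
  ultimately have "card (?S (w @ [e])) = arcs w c d + (if e = d then count_list w c else 0)"
    using snoc by (simp add: card_Un_disjoint)
  then show ?case by (simp add: arcs_append)
qed simp

lemma arc_multiplicity_eq:
  assumes cd: "c \<noteq> d"
  shows "arc_multiplicity [A, B] c d = arcs A c d + arcs B c d"
proof -
  let ?S = "\<lambda>w. {(p, q). p < q \<and> q < length w \<and> w ! p = c \<and> w ! q = d}"
  let ?on = "\<lambda>i (p, q). ((i :: nat, p :: nat), (i, q :: nat))"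
  have "{(e1, e2). e1 \<in> endpoints [A, B] c \<and> e2 \<in> endpoints [A, B] d \<and> below e1 e2}
      = ?on 0 ` ?S A \<union> ?on 1 ` ?S B"
    unfolding endpoints_def below_def
    by (auto simp: less_Suc_eq numeral_2_eq_2 image_iff)
  moreover have "finite (?S w)" for w
    by (rule finite_subset[of _ "{..<length w} \<times> {..<length w}"]) auto
  moreover have "inj_on (?on i) X" for i X by (auto simp: inj_on_def)
  moreover have "?on 0 ` ?S A \<inter> ?on 1 ` ?S B = {}" by auto
  ultimately have "arc_multiplicity [A, B] c d = card (?S A) + card (?S B)"
    unfolding arc_multiplicity_def by (simp only: card_Un_disjoint card_image finite_imageI)
  then show ?thesis by (simp only: card_ordered_positions[OF cd])
qed

lemma uedge_iff_crossing:
  assumes "c \<in> chords [A, B]" "d \<in> chords [A, B]" "c \<noteq> d"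
  shows "{c, d} \<in> uedges (intersection_graph [A, B]) \<longleftrightarrow> crossing A B c d"
proof -
  have "{c, d} \<in> uedges (intersection_graph [A, B])
      \<longleftrightarrow> (c, d) \<in> arcs_mod_2 [A, B] \<and> (d, c) \<in> arcs_mod_2 [A, B]"
    unfolding intersection_graph_def by (auto simp: doubleton_eq_iff)
  then show ?thesis
    using assms arc_multiplicity_eq[of c d A B] arc_multiplicity_eq[of d c A B]
    unfolding arcs_mod_2_def crossing_def by auto
qed

lemma no_loop: "{c} \<notin> uedges (intersection_graph D)"
  unfolding intersection_graph_def arcs_mod_2_def by auto

lemma label_eq: "label (intersection_graph D) c = {i. i < length D \<and> c \<in> set (D ! i)}"
proof -
  have "fst ` S = {i. \<exists>p. (i, p) \<in> S}" for S :: "(nat \<times> nat) set" by force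
  then have "label (intersection_graph D) c = {i. \<exists>p. (i, p) \<in> endpoints D c}"
    unfolding intersection_graph_def by simp
  then show ?thesis unfolding endpoints_def by (auto simp: in_set_conv_nth)
qed

lemma label_iff:
  "0 \<in> label (intersection_graph [A, B]) c \<longleftrightarrow> c \<in> set A"
  "1 \<in> label (intersection_graph [A, B]) c \<longleftrightarrow> c \<in> set B"
  by (simp_all add: label_eq)

lemma marked_if_on_both:
  assumes "c \<in> set A" "c \<in> set B"
  shows "marked (intersection_graph [A, B]) c"
proof -
  have "label (intersection_graph [A, B]) c \<subseteq> {0, 1}"
    by (auto simp: label_eq less_Suc_eq)
  then have "label (intersection_graph [A, B]) c = {0, 1}" using label_iff[of A B c] assms by auto
  then show ?thesis unfolding marked_def by (metis zero_neq_one)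
qed

lemma two_strand_chord_diagram:
  assumes "chord_diagram 2 [A, B]"
  shows "two_strand (chords [A, B]) A B"
  using assms unfolding chord_diagram_def two_strand_def chords_def
  by (auto simp: count_notin)

text \<open>
  What the induction needs from lightness: a marked vertex lies in a bough of the trunk, and a light
  bough has its marked vertex next to the trunk.
\<close>
lemma trimmed_tree_marked_adjacent:
  assumes trunk: "\<forall>B \<in> boughs G v. light_bough G v B"
    and c: "c \<in> vertices G - {v}" "marked G c"
  shows "{v, c} \<in> uedges G"
proof -
  let ?B = "{y. (c, y) \<in> (adjacency_within (uedges G) (vertices G - {v}))\<^sup>*}"
  have "?B \<in> boughs G v" using c unfolding boughs_def by blast
  then have "\<forall>x \<in> ?B. marked G x \<longrightarrow> {v, x} \<in> uedges G"
    using trunk unfolding light_bough_def by (metis (no_types, lifting))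
  then show ?thesis using c(2) by simp
qed

section \<open>Renaming chords\<close>

lemma count_list_map_inj:
  "inj_on g (insert c (set w)) \<Longrightarrow> count_list (map g w) (g c) = count_list w c"
  by (induction w) (auto simp: inj_on_def)

lemma arcs_map_inj:
  "inj_on g (insert c (insert d (set w))) \<Longrightarrow> arcs (map g w) (g c) (g d) = arcs w c d"
proof (induction w)
  case (Cons e w)
  then have "inj_on g (insert c (insert d (set w)))" "inj_on g (insert d (set w))" "g e = g c \<longleftrightarrow> e = c"
    by (auto simp: inj_on_def)
  then show ?case using Cons.IH count_list_map_inj[of g d w] by simp
qed simp

lemma chords_map: "chords (map (map g) D) = g ` chords D"
  unfolding chords_def by auto

lemma diagram_class_map:
  assumes g: "inj_on g (chords D)"
  shows "diagram_class (map (map g) D) = diagram_class D"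
proof (intro equalityI subsetI)
  fix X assume "X \<in> diagram_class (map (map g) D)"
  then obtain h where h: "X = map (map h) (map (map g) D)" "inj_on h (g ` chords D)"
    unfolding diagram_class_def chords_map by blast
  then have "X = map (map (h \<circ> g)) D" "inj_on (h \<circ> g) (chords D)"
    using g by (auto simp: comp_inj_on)
  then show "X \<in> diagram_class D" unfolding diagram_class_def by blast
next
  fix X assume "X \<in> diagram_class D"
  then obtain h where h: "X = map (map h) D" "inj_on h (chords D)"
    unfolding diagram_class_def by blast
  let ?g' = "inv_into (chords D) g"
  have "h (?g' (g c)) = h c" if "w \<in> set D" "c \<in> set w" for w c
    using that g by (subst inv_into_f_f) (auto simp: chords_def)
  then have "X = map (map (h \<circ> ?g')) (map (map g) D)"
    unfolding h(1) by simp
  moreover have "inj_on h (?g' ` g ` chords D)"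
    unfolding inv_into_image_cancel[OF g subset_refl] by (rule h(2))
  then have "inj_on (h \<circ> ?g') (g ` chords D)"
    by (rule comp_inj_on[OF inj_on_inv_into[OF subset_refl]])
  ultimately show "X \<in> diagram_class (map (map g) D)"
    unfolding diagram_class_def chords_map by blast
qed

text \<open>
  The inverse of the graph isomorphism renames the chords of \<open>D2\<close> to those of \<open>D1\<close>; this does not change
  the diagram vector.
\<close>
theorem theorem1:
  fixes D1 D2 :: diagram
  assumes "chord_diagram 2 D1" and "chord_diagram 2 D2"
    and "mixed_graph_iso (intersection_graph D1) (intersection_graph D2)"
    and "trimmed_tree (intersection_graph D1)"
  shows "equivalent_mod_1T_4T 2 D1 D2"
proof -
  obtain A B where D1: "D1 = [A, B]"
    using assms(1) unfolding chord_diagram_def by (auto simp: length_Suc_conv numeral_2_eq_2)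
  obtain A2 B2 where D2: "D2 = [A2, B2]"
    using assms(2) unfolding chord_diagram_def by (auto simp: length_Suc_conv numeral_2_eq_2)
  define V where "V = chords D1"
  define E where "E = uedges (intersection_graph D1)"
  have verts: "vertices (intersection_graph D) = chords D" for D
    unfolding intersection_graph_def by simp
  obtain h where h: "bij_betw h V (chords D2)"
    and lab: "\<And>c. c \<in> V \<Longrightarrow> label (intersection_graph D2) (h c) = label (intersection_graph D1) c"
    and edge: "\<And>c d. c \<in> V \<Longrightarrow> d \<in> V \<Longrightarrow>
      {h c, h d} \<in> uedges (intersection_graph D2) \<longleftrightarrow> {c, d} \<in> E"
    using assms(3) unfolding mixed_graph_iso_def verts V_def E_def by blast
  define g where "g = inv_into V h"
  have g: "bij_betw g (chords D2) V" unfolding g_def by (rule bij_betw_inv_into[OF h])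
  have gh: "g (h c) = c" "h c \<in> chords D2" if "c \<in> V" for c
    using that h unfolding g_def bij_betw_def by auto
  have inj: "inj_on g (chords D2)" using g by (rule bij_betw_imp_inj_on)
  define A' B' where "A' = map g A2" and "B' = map g B2"
  have ch2: "chords D2 = set A2 \<union> set B2" unfolding D2 chords_def by simp
  have inj_sub: "inj_on g (insert c (insert d (set w)))"
    if "c \<in> chords D2" "d \<in> chords D2" "w = A2 \<or> w = B2" for c d w
    using that ch2 by (intro inj_on_subset[OF inj]) auto
  have D: "two_strand V A B" using two_strand_chord_diagram assms(1) unfolding V_def D1 by blast
  have D': "two_strand V A' B'"
    unfolding two_strand_def
  proof
    fix c
    show "count_list A' c + count_list B' c = (if c \<in> V then 2 else 0)"
    proof (cases "c \<in> V")
      case True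
      have "count_list A' (g (h c)) = count_list A2 (h c)" "count_list B' (g (h c)) = count_list B2 (h c)"
        unfolding A'_def B'_def using inj_sub[of "h c" "h c"] gh[OF True]
        by (metis count_list_map_inj insert_absorb2)+
      moreover have "count_list A2 (h c) + count_list B2 (h c) = 2"
        using two_strand_chord_diagram[OF assms(2)[unfolded D2]] gh[OF True]
        unfolding two_strand_def D2[symmetric] by simp
      ultimately show ?thesis using True gh by simp
    next
      case False
      then have "c \<notin> set A'" "c \<notin> set B'"
        unfolding A'_def B'_def using g ch2 by (auto simp: bij_betw_def)
      then show ?thesis using False by (simp add: count_notin)
    qed
  qed
  have lab_sets: "set A' = set A" "set B' = set B"
  proof -
    have V: "V = set A \<union> set B" "V = set A' \<union> set B'" using two_strand_set D D' by auto
    have "c \<in> set A' \<longleftrightarrow> c \<in> set A" "c \<in> set B' \<longleftrightarrow> c \<in> set B" if c: "c \<in> V" for c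
    proof -
      have "c \<in> set (map g w) \<longleftrightarrow> h c \<in> set w" if "w = A2 \<or> w = B2" for w
        using inj_on_image_mem_iff[OF inj, of "h c" "set w"] gh[OF c] that ch2 by auto
      then have "c \<in> set A' \<longleftrightarrow> h c \<in> set A2" "c \<in> set B' \<longleftrightarrow> h c \<in> set B2"
        unfolding A'_def B'_def by auto
      then show "c \<in> set A' \<longleftrightarrow> c \<in> set A" "c \<in> set B' \<longleftrightarrow> c \<in> set B"
        using lab[OF c] label_iff[of A B c] label_iff[of A2 B2 "h c"] unfolding D1 D2 by auto
    qed
    then show "set A' = set A" "set B' = set B" using V by blast+
  qed
  have E: "crossing A B c d \<longleftrightarrow> {c, d} \<in> E" if "c \<in> V" "d \<in> V" "c \<noteq> d" for c d
    using uedge_iff_crossing[of c A B d] that unfolding E_def V_def D1 by simp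
  have E': "crossing A' B' c d \<longleftrightarrow> {c, d} \<in> E" if cd: "c \<in> V" "d \<in> V" "c \<noteq> d" for c d
  proof -
    have "arcs (map g w) (g (h c)) (g (h d)) = arcs w (h c) (h d)"
      "arcs (map g w) (g (h d)) (g (h c)) = arcs w (h d) (h c)" if "w = A2 \<or> w = B2" for w
      using inj_sub[OF gh(2) gh(2)] that cd by (simp_all only: arcs_map_inj)
    then have "crossing A' B' c d \<longleftrightarrow> crossing A2 B2 (h c) (h d)"
      unfolding crossing_def A'_def B'_def using gh cd by simp
    also have "\<dots> \<longleftrightarrow> {h c, h d} \<in> uedges (intersection_graph D2)"
      using uedge_iff_crossing[of "h c" A2 B2 "h d"] gh cd unfolding D2 by metis
    also have "\<dots> \<longleftrightarrow> {c, d} \<in> E" by (rule edge[OF cd(1,2)])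
    finally show ?thesis .
  qed
  obtain v where v: "v \<in> V" and light: "\<forall>B \<in> boughs (intersection_graph D1) v. light_bough (intersection_graph D1) v B"
    and conn: "connected_graph V E" and acyc: "\<nexists>vs. graph_cycle V E vs"
    using assms(4) unfolding trimmed_tree_def undirected_tree_def verts V_def E_def by blast
  have fin: "finite V" unfolding V_def chords_def by simp
  obtain s where s: "s \<notin> V" using ex_new_if_finite[OF infinite_UNIV_nat fin] by blast
  have sA: "s \<notin> set A" "s \<notin> set A'" using s two_strand_set[OF D] two_strand_set[OF D'] by auto
  have "diagram_class D2 = diagram_class [A', B']"
    using diagram_class_map[OF inj] unfolding A'_def B'_def D2 by simp
  then have vec: "diagram_vector D2 = diagram_vector [A', B']" unfolding diagram_vector_def by simp
  show ?thesis
    unfolding equivalent_mod_1T_4T_def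
  proof (rule in_span_if_functionals_vanish)
    fix \<phi> :: "diagram_space \<Rightarrow> real"
    assume lin: "linear \<phi>" and zero: "\<And>r. r \<in> one_term_relators 2 \<union> four_term_relators 2 \<Longrightarrow> \<phi> r = 0"
    have "four_term s V (\<lambda>Y. \<phi> (diagram_vector (unflatten s Y)))"
      using zero by (intro four_term_of_functional[OF lin]) auto
    from trimmed_tree_determines_value[OF fin this s v D D' lab_sets E E' _ _ acyc]
    have "\<phi> (diagram_vector (unflatten s (A @ s # B))) = \<phi> (diagram_vector (unflatten s (A' @ s # B')))"
      using no_loop conn v trimmed_tree_marked_adjacent[OF light] marked_if_on_both
      unfolding connected_graph_def E_def verts V_def D1 by blast
    then show "\<phi> (diagram_vector D1 - diagram_vector D2) = 0"
      using sA by (simp add: unflatten_eq linear_diff[OF lin] D1 vec)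
  qed
qed

end
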